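(* Let $(\mathfrak{E},h)=(E,\Phi,h)$ be a hermitian Higgs bundle over a compact Kähler manifold $M$ and let $D_h$ be the Chern connection of $(E,h)$. Let $E'\subset E$ be a $D_h$-invariant $C^\infty$ complex subbundle and $E''$ the orthogonal complement of $E'$ with respect to $h$. Suppose that $E'$ is $\Phi$-invariant and also $\bar\Phi_h$-invariant. Then both $\mathfrak{E}'=(E',\Phi|_{E'})$ and $\mathfrak{E}''=(E'',\Phi|_{E''})$ are $D_h$-invariant Higgs subbundles of $\mathfrak{E}=(E,\Phi)$ and they give a Higgs orthogonal decomposition $$\mathfrak{E}=\mathfrak{E}'\oplus\mathfrak{E}''.$$
   Context: $M$ is a compact Kähler manifold with holomorphic cotangent bundle $\Omega^{1,0}$ and complex conjugate bundle $\Omega^{0,1}$. For a $C^\infty$ complex vector bundle $V$ over $M$, $A^s(V)$ (resp. $A^{p,q}(V)$) is the space of $C^\infty$ complex $s$-forms (resp. $(p,q)$-forms) on $M$ with values in $V$. A Higgs bundle $\mathfrak{E}=(E,\Phi)$ over $M$ is a holomorphic vector bundle $E$ with a holomorphic $\Phi\in A^{1,0}(\mathrm{End}\,E)$ (the Higgs field) satisfying $\Phi\wedge\Phi=0$. A hermitian Higgs bundle $(\mathfrak{E},h)=(E,\Phi,h)$ is a Higgs bundle with a hermitian metric $h$ in $E$. $\bar\Phi_h\in A^{0,1}(\mathrm{End}\,E)$ is the hermitian conjugate of $\Phi$ with respect to $h$, i.e. $h(\bar\Phi_h\xi,\eta)=h(\xi,\Phi\eta)$ for all sections $\xi,\eta$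 of $E$. A $C^\infty$ complex subbundle $F\subset E$ is $D_h$-invariant if $D_h$ maps $A^0(F)$ into $A^1(F)$; it is $\Phi$-invariant (resp. $\bar\Phi_h$-invariant) if $\Phi(F)\subset F\otimes\Omega^{1,0}$ (resp. $\bar\Phi_h(F)\subset F\otimes\Omega^{0,1}$). A Higgs subbundle of $\mathfrak{E}$ is a $\Phi$-invariant holomorphic subbundle $F\subset E$, regarded as the Higgs bundle $(F,\Phi|_F)$; it is called $D_h$-invariant if $F$ is. A Higgs orthogonal decomposition $\mathfrak{E}=\mathfrak{E}'\oplus\mathfrak{E}''$ is a holomorphic direct sum decomposition $E=E'\oplus E''$, orthogonal with respect to $h$, in which $\mathfrak{E}'$ and $\mathfrak{E}''$ are Higgs subbundles of $\mathfrak{E}$. *)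

theory Defs
  imports "HOL-Analysis.Analysis"
begin

section \<open>Smooth and holomorphic functions on open subsets of complex coordinate space\<close>

primrec Ck_on :: "nat \<Rightarrow> 'a::real_normed_vector set \<Rightarrow> ('a \<Rightarrow> 'b::real_normed_vector) \<Rightarrow> bool" where
  "Ck_on 0 S f \<longleftrightarrow> continuous_on S f"
| "Ck_on (Suc k) S f \<longleftrightarrow>
     (\<forall>x\<in>S. f differentiable (at x)) \<and>
     (\<forall>v. Ck_on k S (\<lambda>x. frechet_derivative f (at x) v))"

definition smooth_on :: "'a::real_normed_vector set \<Rightarrow> ('a \<Rightarrow> 'b::real_normed_vector) \<Rightarrow> bool" where
  "smooth_on S f \<longleftrightarrow> (\<forall>k. Ck_on k S f)"

text \<open>A function of several complex variables is called holomorphic if it is smooth and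
  satisfies the Cauchy-Riemann equations, i.e. the conjugate-linear part of its real derivative
  vanishes.\<close>

definition holomorphic_fun_on :: "(complex^'n::finite) set \<Rightarrow> (complex^'n \<Rightarrow> complex) \<Rightarrow> bool" where
  "holomorphic_fun_on S f \<longleftrightarrow> smooth_on S f \<and>
     (\<forall>z\<in>S. \<forall>v. (frechet_derivative f (at z) v
                     + \<i> * frechet_derivative f (at z) (\<i> *s v)) / 2 = 0)"


section \<open>Complex manifolds\<close>

text \<open>The underlying topological space of a manifold is a whole type; a chart is a pair consisting
  of its domain and its coordinate map.\<close>

type_synonym ('m, 'n) chart = "'m set \<times> ('m \<Rightarrow> complex^'n)"

definition chart_inv :: "('m, 'n::finite) chart \<Rightarrow> complex^'n \<Rightarrow> 'm" where
  "chart_inv c = inv_into (fst c) (snd c)"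

definition smooth_map ::
  "('m, 'n::finite) chart set \<Rightarrow> 'm set \<Rightarrow> ('m \<Rightarrow> 'b::real_normed_vector) \<Rightarrow> bool" where
  "smooth_map A U f \<longleftrightarrow> (\<forall>c\<in>A. smooth_on (snd c ` (U \<inter> fst c)) (f \<circ> chart_inv c))"

definition holomorphic_map ::
  "('m, 'n::finite) chart set \<Rightarrow> 'm set \<Rightarrow> ('m \<Rightarrow> complex) \<Rightarrow> bool" where
  "holomorphic_map A U f \<longleftrightarrow>
     (\<forall>c\<in>A. holomorphic_fun_on (snd c ` (U \<inter> fst c)) (f \<circ> chart_inv c))"

definition complex_manifold ::
  "('m::{t2_space,second_countable_topology}, 'n::finite) chart set \<Rightarrow> bool" where
  "complex_manifold A \<longleftrightarrow>
     (\<Union>c\<in>A. fst c) = UNIV \<and>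
     (\<forall>c\<in>A. open (fst c) \<and> open (snd c ` fst c) \<and>
             homeomorphism (fst c) (snd c ` fst c) (snd c) (chart_inv c)) \<and>
     (\<forall>c\<in>A. \<forall>i. holomorphic_map A (fst c) (\<lambda>x. snd c x $ i))"

text \<open>The derivative at \<open>x\<close> of a function on the manifold, applied to the real tangent vector whose
  coordinates in the chart \<open>c\<close> are \<open>v\<close>.  In particular \<open>mdiff (snd c') c x\<close> is the Jacobian of the
  coordinate change from \<open>c\<close> to \<open>c'\<close>.\<close>

definition mdiff ::
  "('m \<Rightarrow> 'b::real_normed_vector) \<Rightarrow> ('m, 'n::finite) chart \<Rightarrow> 'm \<Rightarrow> complex^'n \<Rightarrow> 'b" where
  "mdiff f c x v = frechet_derivative (f \<circ> chart_inv c) (at (snd c x)) v"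

text \<open>The \<open>(0,1)\<close>-part of the differential of a complex function.\<close>

definition mdbar ::
  "('m \<Rightarrow> complex) \<Rightarrow> ('m, 'n::finite) chart \<Rightarrow> 'm \<Rightarrow> complex^'n \<Rightarrow> complex" where
  "mdbar f c x v = (mdiff f c x v + \<i> * mdiff f c x (\<i> *s v)) / 2"

text \<open>A real tangent vector at \<open>x\<close> is represented by its coordinate vector in a chart around \<open>x\<close>, on
  which multiplication by \<open>\<i>\<close> is the complex structure.  Tensor fields \<open>t\<close> are therefore given in the
  form \<open>t c x v \<dots>\<close>, where \<open>v, \<dots>\<close> are the coordinates in the chart \<open>c\<close> of tangent vectors at \<open>x\<close>,
  together with the transformation law under changes of charts.  Complex-valued forms
  are real multilinear in the tangent vectors; a one-form is of type \<open>(1,0)\<close> if it is complex linear,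
  and of type \<open>(0,1)\<close> if it is conjugate linear.  Values at points \<open>x\<close> outside \<open>fst c\<close> are junk.\<close>

type_synonym ('m, 'n) metric_field = "('m, 'n) chart \<Rightarrow> 'm \<Rightarrow> complex^'n \<Rightarrow> complex^'n \<Rightarrow> complex"

definition hermitian_manifold_metric ::
  "('m, 'n::finite) chart set \<Rightarrow> ('m, 'n) metric_field \<Rightarrow> bool" where
  "hermitian_manifold_metric A g \<longleftrightarrow>
     (\<forall>c\<in>A. \<forall>x\<in>fst c.
        (\<forall>u v w. g c x (u + v) w = g c x u w + g c x v w) \<and>
        (\<forall>a v w. g c x (a *s v) w = a * g c x v w) \<and>
        (\<forall>v w. g c x w v = cnj (g c x v w)) \<and>
        (\<forall>v. v \<noteq> 0 \<longrightarrow> 0 < Re (g c x v v))) \<and>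
     (\<forall>c\<in>A. \<forall>c'\<in>A. \<forall>x\<in>fst c \<inter> fst c'. \<forall>v w.
        g c x v w = g c' x (mdiff (snd c') c x v) (mdiff (snd c') c x w)) \<and>
     (\<forall>c\<in>A. \<forall>v w. smooth_map A (fst c) (\<lambda>x. g c x v w))"

text \<open>The fundamental two-form \<open>(\<i>/2) \<Sum> g\<^sub>j\<^sub>k dz\<^sub>j \<and> d\<zeta>\<^sub>k\<close>, where \<open>\<zeta>\<^sub>k\<close> is the conjugate of \<open>z\<^sub>k\<close>,
  evaluated on two real tangent vectors.\<close>

definition fundamental_form ::
  "('m, 'n::finite) metric_field \<Rightarrow> ('m, 'n) chart \<Rightarrow> 'm \<Rightarrow> complex^'n \<Rightarrow> complex^'n \<Rightarrow> real" where
  "fundamental_form g c x v w = - Im (g c x v w)"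

text \<open>The last clause says that the exterior derivative of the fundamental form, evaluated on
  coordinate vector fields with constant coefficients, vanishes.\<close>

definition kaehler_metric :: "('m, 'n::finite) chart set \<Rightarrow> ('m, 'n) metric_field \<Rightarrow> bool" where
  "kaehler_metric A g \<longleftrightarrow> hermitian_manifold_metric A g \<and>
     (\<forall>c\<in>A. \<forall>x\<in>fst c. \<forall>u v w.
        mdiff (\<lambda>y. fundamental_form g c y v w) c x u
        - mdiff (\<lambda>y. fundamental_form g c y u w) c x v
        + mdiff (\<lambda>y. fundamental_form g c y u v) c x w = 0)"

definition compact_kaehler_manifold ::
  "('m::{t2_space,second_countable_topology}, 'n::finite) chart set
    \<Rightarrow> ('m, 'n) metric_field \<Rightarrow> bool" where
  "compact_kaehler_manifold A g \<longleftrightarrow>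
     compact (UNIV :: 'm set) \<and> complex_manifold A \<and> kaehler_metric A g"


section \<open>Holomorphic vector bundles and their sections\<close>

text \<open>The total space of a bundle is a whole type, with projection \<open>bproj\<close> and fibrewise vector
  space operations.  A local trivialization is a pair of an open set \<open>U\<close> and the fibre component of
  an isomorphism from the restriction of the bundle to \<open>U\<close> onto the product of \<open>U\<close> with the model
  fibre.\<close>

record ('e, 'm, 'r) vbundle =
  bproj :: "'e \<Rightarrow> 'm"
  bzero :: "'m \<Rightarrow> 'e"
  badd :: "'e \<Rightarrow> 'e \<Rightarrow> 'e"
  bscale :: "complex \<Rightarrow> 'e \<Rightarrow> 'e"
  btriv :: "('m set \<times> ('e \<Rightarrow> complex^'r)) set"

definition fib :: "('e, 'm, 'r::finite) vbundle \<Rightarrow> 'm \<Rightarrow> 'e set" where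
  "fib E x = {e. bproj E e = x}"

definition holomorphic_vbundle ::
  "('m::topological_space, 'n::finite) chart set \<Rightarrow> ('e, 'm, 'r::finite) vbundle \<Rightarrow> bool" where
  "holomorphic_vbundle A E \<longleftrightarrow>
     (\<forall>x. bzero E x \<in> fib E x \<and>
          (\<forall>e\<in>fib E x. \<forall>f\<in>fib E x. badd E e f \<in> fib E x) \<and>
          (\<forall>a. \<forall>e\<in>fib E x. bscale E a e \<in> fib E x)) \<and>
     (\<Union>(U, \<tau>)\<in>btriv E. U) = UNIV \<and>
     (\<forall>(U, \<tau>)\<in>btriv E. open U \<and>
        (\<forall>x\<in>U. bij_betw \<tau> (fib E x) UNIV \<and> \<tau> (bzero E x) = 0 \<and>
          (\<forall>e\<in>fib E x. \<forall>f\<in>fib E x. \<tau> (badd E e f) = \<tau> e + \<tau> f) \<and>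
          (\<forall>a. \<forall>e\<in>fib E x. \<tau> (bscale E a e) = a *s \<tau> e))) \<and>
     (\<forall>(U, \<tau>)\<in>btriv E. \<forall>(V, \<sigma>)\<in>btriv E. \<exists>G :: 'm \<Rightarrow> complex^'r^'r.
        (\<forall>x\<in>U \<inter> V. invertible (G x) \<and> (\<forall>e\<in>fib E x. \<sigma> e = G x *v \<tau> e)) \<and>
        (\<forall>i j. holomorphic_map A (U \<inter> V) (\<lambda>x. G x $ i $ j)))"

text \<open>The inverse of a trivialization on the fibre over \<open>x\<close>; for fixed \<open>w\<close> the section
  \<open>\<lambda>x. triv_inv E \<tau> x w\<close> has constant components with respect to \<open>\<tau>\<close>.\<close>

definition triv_inv ::
  "('e, 'm, 'r::finite) vbundle \<Rightarrow> ('e \<Rightarrow> complex^'r) \<Rightarrow> 'm \<Rightarrow> complex^'r \<Rightarrow> 'e" where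
  "triv_inv E \<tau> x w = inv_into (fib E x) \<tau> w"

definition smooth_section ::
  "('m, 'n::finite) chart set \<Rightarrow> ('e, 'm, 'r::finite) vbundle \<Rightarrow> 'm set \<Rightarrow> ('m \<Rightarrow> 'e) \<Rightarrow> bool" where
  "smooth_section A E U s \<longleftrightarrow> (\<forall>x\<in>U. s x \<in> fib E x) \<and>
     (\<forall>(V, \<tau>)\<in>btriv E. smooth_map A (U \<inter> V) (\<lambda>x. \<tau> (s x)))"

definition holomorphic_section ::
  "('m, 'n::finite) chart set \<Rightarrow> ('e, 'm, 'r::finite) vbundle \<Rightarrow> 'm set \<Rightarrow> ('m \<Rightarrow> 'e) \<Rightarrow> bool" where
  "holomorphic_section A E U s \<longleftrightarrow> (\<forall>x\<in>U. s x \<in> fib E x) \<and>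
     (\<forall>(V, \<tau>)\<in>btriv E. \<forall>i. holomorphic_map A (U \<inter> V) (\<lambda>x. \<tau> (s x) $ i))"

definition A0 :: "('m, 'n::finite) chart set \<Rightarrow> ('e, 'm, 'r::finite) vbundle \<Rightarrow> ('m \<Rightarrow> 'e) set" where
  "A0 A E = {s. smooth_section A E UNIV s}"

type_synonym ('e, 'm, 'n) vform = "('m, 'n) chart \<Rightarrow> 'm \<Rightarrow> complex^'n \<Rightarrow> 'e"

definition A1 ::
  "('m, 'n::finite) chart set \<Rightarrow> ('e, 'm, 'r::finite) vbundle \<Rightarrow> ('e, 'm, 'n) vform set" where
  "A1 A E = {\<alpha>.
     (\<forall>c\<in>A. \<forall>x\<in>fst c.
        (\<forall>v. \<alpha> c x v \<in> fib E x) \<and>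
        (\<forall>v w. \<alpha> c x (v + w) = badd E (\<alpha> c x v) (\<alpha> c x w)) \<and>
        (\<forall>a v. \<alpha> c x (a *\<^sub>R v) = bscale E (complex_of_real a) (\<alpha> c x v))) \<and>
     (\<forall>c\<in>A. \<forall>c'\<in>A. \<forall>x\<in>fst c \<inter> fst c'. \<forall>v. \<alpha> c x v = \<alpha> c' x (mdiff (snd c') c x v)) \<and>
     (\<forall>c\<in>A. \<forall>v. smooth_section A E (fst c) (\<lambda>x. \<alpha> c x v))}"


section \<open>Hermitian metrics and the Chern connection\<close>

definition hermitian_metric ::
  "('m, 'n::finite) chart set \<Rightarrow> ('e, 'm, 'r::finite) vbundle \<Rightarrow> ('e \<Rightarrow> 'e \<Rightarrow> complex) \<Rightarrow> bool" where
  "hermitian_metric A E h \<longleftrightarrow>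
     (\<forall>x. \<forall>e\<in>fib E x. \<forall>f\<in>fib E x.
        (\<forall>e'\<in>fib E x. h (badd E e e') f = h e f + h e' f) \<and>
        (\<forall>a. h (bscale E a e) f = a * h e f) \<and>
        h f e = cnj (h e f)) \<and>
     (\<forall>x. \<forall>e\<in>fib E x. e \<noteq> bzero E x \<longrightarrow> 0 < Re (h e e)) \<and>
     (\<forall>(U, \<tau>)\<in>btriv E. \<forall>w w'. smooth_map A U (\<lambda>x. h (triv_inv E \<tau> x w) (triv_inv E \<tau> x w')))"

type_synonym ('e, 'm, 'n) conn = "('m \<Rightarrow> 'e) \<Rightarrow> ('e, 'm, 'n) vform"

definition connection ::
  "('m, 'n::finite) chart set \<Rightarrow> ('e, 'm, 'r::finite) vbundle \<Rightarrow> ('e, 'm, 'n) conn \<Rightarrow> bool" where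
  "connection A E D \<longleftrightarrow>
     (\<forall>s\<in>A0 A E. D s \<in> A1 A E) \<and>
     (\<forall>s\<in>A0 A E. \<forall>t\<in>A0 A E. \<forall>c\<in>A. \<forall>x\<in>fst c. \<forall>v.
        D (\<lambda>y. badd E (s y) (t y)) c x v = badd E (D s c x v) (D t c x v)) \<and>
     (\<forall>f. \<forall>s\<in>A0 A E. smooth_map A UNIV f \<longrightarrow> (\<forall>c\<in>A. \<forall>x\<in>fst c. \<forall>v.
        D (\<lambda>y. bscale E (f y) (s y)) c x v
          = badd E (bscale E (mdiff f c x v) (s x)) (bscale E (f x) (D s c x v))))"

text \<open>The \<open>(0,1)\<close>-part of a bundle-valued one-form.\<close>

definition part01 ::
  "('e, 'm, 'r::finite) vbundle \<Rightarrow> ('e, 'm, 'n::finite) vform \<Rightarrow> ('e, 'm, 'n) vform" where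
  "part01 E \<alpha> c x v = bscale E (1/2) (badd E (\<alpha> c x v) (bscale E \<i> (\<alpha> c x (\<i> *s v))))"

text \<open>The Chern connection is the connection that preserves the metric and whose \<open>(0,1)\<close>-part is the
  Dolbeault operator of the bundle, which acts componentwise in every holomorphic trivialization.\<close>

definition chern_connection ::
  "('m, 'n::finite) chart set \<Rightarrow> ('e, 'm, 'r::finite) vbundle \<Rightarrow> ('e \<Rightarrow> 'e \<Rightarrow> complex)
    \<Rightarrow> ('e, 'm, 'n) conn \<Rightarrow> bool" where
  "chern_connection A E h D \<longleftrightarrow> connection A E D \<and>
     (\<forall>s\<in>A0 A E. \<forall>t\<in>A0 A E. \<forall>c\<in>A. \<forall>x\<in>fst c. \<forall>v.
        mdiff (\<lambda>y. h (s y) (t y)) c x v = h (D s c x v) (t x) + h (s x) (D t c x v)) \<and>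
     (\<forall>s\<in>A0 A E. \<forall>c\<in>A. \<forall>(U, \<tau>)\<in>btriv E. \<forall>x\<in>fst c \<inter> U. \<forall>v i.
        \<tau> (part01 E (D s) c x v) $ i = mdbar (\<lambda>y. \<tau> (s y) $ i) c x v)"


section \<open>Endomorphism-valued forms and Higgs bundles\<close>

type_synonym ('e, 'm, 'n) eform = "('m, 'n) chart \<Rightarrow> 'm \<Rightarrow> complex^'n \<Rightarrow> 'e \<Rightarrow> 'e"

definition A1_End ::
  "('m, 'n::finite) chart set \<Rightarrow> ('e, 'm, 'r::finite) vbundle \<Rightarrow> ('e, 'm, 'n) eform set" where
  "A1_End A E = {\<Phi>.
     (\<forall>c\<in>A. \<forall>x\<in>fst c. \<forall>e\<in>fib E x.
        (\<forall>v. \<Phi> c x v e \<in> fib E x) \<and>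
        (\<forall>v. \<forall>f\<in>fib E x. \<Phi> c x v (badd E e f) = badd E (\<Phi> c x v e) (\<Phi> c x v f)) \<and>
        (\<forall>v a. \<Phi> c x v (bscale E a e) = bscale E a (\<Phi> c x v e)) \<and>
        (\<forall>v w. \<Phi> c x (v + w) e = badd E (\<Phi> c x v e) (\<Phi> c x w e)) \<and>
        (\<forall>a v. \<Phi> c x (a *\<^sub>R v) e = bscale E (complex_of_real a) (\<Phi> c x v e))) \<and>
     (\<forall>c\<in>A. \<forall>c'\<in>A. \<forall>x\<in>fst c \<inter> fst c'. \<forall>v. \<forall>e\<in>fib E x.
        \<Phi> c x v e = \<Phi> c' x (mdiff (snd c') c x v) e) \<and>
     (\<forall>c\<in>A. \<forall>(U, \<tau>)\<in>btriv E. \<forall>v w.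
        smooth_section A E (fst c \<inter> U) (\<lambda>x. \<Phi> c x v (triv_inv E \<tau> x w)))}"

definition A10_End ::
  "('m, 'n::finite) chart set \<Rightarrow> ('e, 'm, 'r::finite) vbundle \<Rightarrow> ('e, 'm, 'n) eform set" where
  "A10_End A E = {\<Phi> \<in> A1_End A E.
     \<forall>c\<in>A. \<forall>x\<in>fst c. \<forall>e\<in>fib E x. \<forall>v. \<Phi> c x (\<i> *s v) e = bscale E \<i> (\<Phi> c x v e)}"

definition A01_End ::
  "('m, 'n::finite) chart set \<Rightarrow> ('e, 'm, 'r::finite) vbundle \<Rightarrow> ('e, 'm, 'n) eform set" where
  "A01_End A E = {\<Phi> \<in> A1_End A E.
     \<forall>c\<in>A. \<forall>x\<in>fst c. \<forall>e\<in>fib E x. \<forall>v. \<Phi> c x (\<i> *s v) e = bscale E (- \<i>) (\<Phi> c x v e)}"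

text \<open>A \<open>(1,0)\<close>-form is holomorphic if its coefficients in holomorphic coordinates and holomorphic
  frames are.\<close>

definition holomorphic_A10_End ::
  "('m, 'n::finite) chart set \<Rightarrow> ('e, 'm, 'r::finite) vbundle \<Rightarrow> ('e, 'm, 'n) eform set" where
  "holomorphic_A10_End A E = {\<Phi> \<in> A10_End A E.
     \<forall>c\<in>A. \<forall>(U, \<tau>)\<in>btriv E. \<forall>v w.
       holomorphic_section A E (fst c \<inter> U) (\<lambda>x. \<Phi> c x v (triv_inv E \<tau> x w))}"

text \<open>The wedge product of two endomorphism-valued one-forms, evaluated on two tangent vectors.\<close>

definition wedge_End ::
  "('e, 'm, 'r::finite) vbundle \<Rightarrow> ('e, 'm, 'n::finite) eform \<Rightarrow> ('e, 'm, 'n) eform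
    \<Rightarrow> ('m, 'n) chart \<Rightarrow> 'm \<Rightarrow> complex^'n \<Rightarrow> complex^'n \<Rightarrow> 'e \<Rightarrow> 'e" where
  "wedge_End E \<Phi> \<Psi> c x v w e =
     badd E (\<Phi> c x v (\<Psi> c x w e)) (bscale E (- 1) (\<Phi> c x w (\<Psi> c x v e)))"

definition higgs_bundle ::
  "('m::topological_space, 'n::finite) chart set \<Rightarrow> ('e, 'm, 'r::finite) vbundle
    \<Rightarrow> ('e, 'm, 'n) eform \<Rightarrow> bool" where
  "higgs_bundle A E \<Phi> \<longleftrightarrow> holomorphic_vbundle A E \<and> \<Phi> \<in> holomorphic_A10_End A E \<and>
     (\<forall>c\<in>A. \<forall>x\<in>fst c. \<forall>v w. \<forall>e\<in>fib E x. wedge_End E \<Phi> \<Phi> c x v w e = bzero E x)"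

definition hermitian_higgs_bundle ::
  "('m::topological_space, 'n::finite) chart set \<Rightarrow> ('e, 'm, 'r::finite) vbundle
    \<Rightarrow> ('e, 'm, 'n) eform \<Rightarrow> ('e \<Rightarrow> 'e \<Rightarrow> complex) \<Rightarrow> bool" where
  "hermitian_higgs_bundle A E \<Phi> h \<longleftrightarrow> higgs_bundle A E \<Phi> \<and> hermitian_metric A E h"

text \<open>\<open>\<Phi>h\<close> is the hermitian conjugate of \<open>\<Phi>\<close>.  The tangent vector \<open>v\<close> is real, so conjugating a form
  amounts to taking adjoints of its values.\<close>

definition hermitian_conjugate ::
  "('m, 'n::finite) chart set \<Rightarrow> ('e, 'm, 'r::finite) vbundle \<Rightarrow> ('e \<Rightarrow> 'e \<Rightarrow> complex)
    \<Rightarrow> ('e, 'm, 'n) eform \<Rightarrow> ('e, 'm, 'n) eform \<Rightarrow> bool" where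
  "hermitian_conjugate A E h \<Phi> \<Phi>h \<longleftrightarrow> \<Phi>h \<in> A01_End A E \<and>
     (\<forall>c\<in>A. \<forall>x\<in>fst c. \<forall>v. \<forall>\<xi>\<in>fib E x. \<forall>\<eta>\<in>fib E x. h (\<Phi>h c x v \<xi>) \<eta> = h \<xi> (\<Phi> c x v \<eta>))"


section \<open>Subbundles and Higgs orthogonal decompositions\<close>

primrec lincomb ::
  "('e, 'm, 'r::finite) vbundle \<Rightarrow> 'm \<Rightarrow> (nat \<Rightarrow> complex) \<Rightarrow> (nat \<Rightarrow> 'e) \<Rightarrow> nat \<Rightarrow> 'e" where
  "lincomb E x a s 0 = bzero E x"
| "lincomb E x a s (Suc k) = badd E (lincomb E x a s k) (bscale E (a k) (s k))"

definition frame_over ::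
  "('e, 'm, 'r::finite) vbundle \<Rightarrow> 'e set \<Rightarrow> nat \<Rightarrow> 'm set \<Rightarrow> (nat \<Rightarrow> 'm \<Rightarrow> 'e) \<Rightarrow> bool" where
  "frame_over E F k U s \<longleftrightarrow>
     (\<forall>x\<in>U. F \<inter> fib E x = {lincomb E x a (\<lambda>i. s i x) k | a. True} \<and>
            (\<forall>a. lincomb E x a (\<lambda>i. s i x) k = bzero E x \<longrightarrow> (\<forall>i<k. a i = 0)))"

text \<open>Subbundles, as subsets of the total space, have constant rank, which may be zero.\<close>

definition smooth_subbundle ::
  "('m::topological_space, 'n::finite) chart set \<Rightarrow> ('e, 'm, 'r::finite) vbundle
    \<Rightarrow> 'e set \<Rightarrow> bool" where
  "smooth_subbundle A E F \<longleftrightarrow> (\<exists>k. \<forall>x. \<exists>U s. open U \<and> x \<in> U \<and>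
     (\<forall>i<k. smooth_section A E U (s i)) \<and> frame_over E F k U s)"

definition holomorphic_subbundle ::
  "('m::topological_space, 'n::finite) chart set \<Rightarrow> ('e, 'm, 'r::finite) vbundle
    \<Rightarrow> 'e set \<Rightarrow> bool" where
  "holomorphic_subbundle A E F \<longleftrightarrow> (\<exists>k. \<forall>x. \<exists>U s. open U \<and> x \<in> U \<and>
     (\<forall>i<k. holomorphic_section A E U (s i)) \<and> frame_over E F k U s)"

definition A0_sub ::
  "('m, 'n::finite) chart set \<Rightarrow> ('e, 'm, 'r::finite) vbundle \<Rightarrow> 'e set \<Rightarrow> ('m \<Rightarrow> 'e) set" where
  "A0_sub A E F = {s \<in> A0 A E. \<forall>x. s x \<in> F}"

definition A1_sub ::
  "('m, 'n::finite) chart set \<Rightarrow> ('e, 'm, 'r::finite) vbundle \<Rightarrow> 'e set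
    \<Rightarrow> ('e, 'm, 'n) vform set" where
  "A1_sub A E F = {\<alpha> \<in> A1 A E. \<forall>c\<in>A. \<forall>x\<in>fst c. \<forall>v. \<alpha> c x v \<in> F}"

definition connection_invariant ::
  "('m, 'n::finite) chart set \<Rightarrow> ('e, 'm, 'r::finite) vbundle \<Rightarrow> ('e, 'm, 'n) conn
    \<Rightarrow> 'e set \<Rightarrow> bool" where
  "connection_invariant A E D F \<longleftrightarrow> (\<forall>s\<in>A0_sub A E F. D s \<in> A1_sub A E F)"

definition eform_invariant ::
  "('m, 'n::finite) chart set \<Rightarrow> ('e, 'm, 'r::finite) vbundle \<Rightarrow> ('e, 'm, 'n) eform
    \<Rightarrow> 'e set \<Rightarrow> bool" where
  "eform_invariant A E \<Phi> F \<longleftrightarrow> (\<forall>c\<in>A. \<forall>x\<in>fst c. \<forall>v. \<forall>e\<in>F \<inter> fib E x. \<Phi> c x v e \<in> F)"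

definition orthogonal_complement ::
  "('e, 'm, 'r::finite) vbundle \<Rightarrow> ('e \<Rightarrow> 'e \<Rightarrow> complex) \<Rightarrow> 'e set \<Rightarrow> 'e set" where
  "orthogonal_complement E h F = {e. \<forall>f\<in>F \<inter> fib E (bproj E e). h e f = 0}"

definition higgs_subbundle ::
  "('m::topological_space, 'n::finite) chart set \<Rightarrow> ('e, 'm, 'r::finite) vbundle
    \<Rightarrow> ('e, 'm, 'n) eform \<Rightarrow> 'e set \<Rightarrow> bool" where
  "higgs_subbundle A E \<Phi> F \<longleftrightarrow> holomorphic_subbundle A E F \<and> eform_invariant A E \<Phi> F"

definition holomorphic_direct_sum ::
  "('m::topological_space, 'n::finite) chart set \<Rightarrow> ('e, 'm, 'r::finite) vbundle
    \<Rightarrow> 'e set \<Rightarrow> 'e set \<Rightarrow> bool" where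
  "holomorphic_direct_sum A E F G \<longleftrightarrow>
     holomorphic_subbundle A E F \<and> holomorphic_subbundle A E G \<and>
     (\<forall>x. \<forall>e\<in>fib E x. \<exists>!(f, g). f \<in> F \<inter> fib E x \<and> g \<in> G \<inter> fib E x \<and> e = badd E f g)"

definition higgs_orthogonal_decomposition ::
  "('m::topological_space, 'n::finite) chart set \<Rightarrow> ('e, 'm, 'r::finite) vbundle
    \<Rightarrow> ('e, 'm, 'n) eform \<Rightarrow> ('e \<Rightarrow> 'e \<Rightarrow> complex) \<Rightarrow> 'e set \<Rightarrow> 'e set \<Rightarrow> bool" where
  "higgs_orthogonal_decomposition A E \<Phi> h F G \<longleftrightarrow>
     holomorphic_direct_sum A E F G \<and>
     (\<forall>x. \<forall>f\<in>F \<inter> fib E x. \<forall>g\<in>G \<inter> fib E x. h f g = 0) \<and>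
     higgs_subbundle A E \<Phi> F \<and> higgs_subbundle A E \<Phi> G"

end

theory Submission
  imports Defs
begin

text \<open>
  A subbundle that is invariant under the Chern connection is invariant under its \<open>(0,1)\<close>-part, the
  Dolbeault operator of \<open>E\<close>, and this forces it to be holomorphic.  No integrability theorem is needed.
  In a trivialization a smooth local frame can be row reduced, so that for suitable pivot coordinates
  \<open>p\<^sub>l\<close> the frame vectors satisfy \<open>(s\<^sub>i)\<^sub>p\<^sub>l = \<delta>\<^sub>i\<^sub>l\<close> (\<open>smooth_row_reduction\<close>).  The Dolbeault derivative of
  \<open>s\<^sub>i\<close> lies in the subbundle again, while its pivot coordinates are derivatives of constants and so
  vanish; a vector in the span of the frame with vanishing pivot coordinates is zero.  Hence every \<open>s\<^sub>i\<close>
  is holomorphic (\<open>normalized_section_holomorphic\<close>).  Since the connection acts on global sections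
  only, the local sections have to be cut off, which requires smooth bump functions (\<open>ex_bump\<close>) and
  extended sections (\<open>extend_section\<close>).

  The complement \<open>E''\<close> is treated by the same criterion.  In a trivialization its fibres are the kernel
  of the rows \<open>h(-, s\<^sub>i)\<close>; after row reduction of these rows the usual basis of the kernel is a smooth
  frame that is again normalized (\<open>orthogonal_complement_normal_frames\<close>).  Invariance of \<open>E''\<close> under
  the connection follows by differentiating \<open>h(s, t) = 0\<close> for sections \<open>s\<close> of \<open>E''\<close> and \<open>t\<close> of \<open>E'\<close>,
  using that every vector of \<open>E'\<close> is a value of some \<open>t\<close> (\<open>section_through\<close>).  The relation
  \<open>h(\<Phi>\<^sub>h \<xi>, \<eta>) = h(\<xi>, \<Phi> \<eta>)\<close> turns invariance of \<open>E'\<close> under the adjoint into invariance of \<open>E''\<close> under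
  \<open>\<Phi>\<close>.  The direct sum decomposition is fibrewise orthogonal projection.
\<close>

section \<open>Calculus of functions of class \<open>C\<^sup>k\<close>\<close>

text \<open>No differentiability is assumed: \<open>frechet_derivative\<close> depends only on the set of derivatives at the
  point, which is the same for both functions.\<close>

lemma frechet_derivative_cong_open:
  assumes "open S" "x \<in> S" "\<And>y. y \<in> S \<Longrightarrow> f y = g y"
  shows "frechet_derivative f (at x) = frechet_derivative g (at x)"
proof -
  have "(f has_derivative f') (at x) \<longleftrightarrow> (g has_derivative f') (at x)" for f'
    using has_derivative_transform_within_open[of f f' x UNIV S g]
      has_derivative_transform_within_open[of g f' x UNIV S f] assms by auto
  then show ?thesis
    by (simp add: frechet_derivative_def)
qed

lemma differentiable_cong_open:
  assumes "open S" "x \<in> S" "\<And>y. y \<in> S \<Longrightarrow> f y = g y" "f differentiable (at x)"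
  shows "g differentiable (at x)"
  using assms has_derivative_transform_within_open[of f _ x UNIV S g]
  unfolding differentiable_def by metis

lemma Ck_on_cong:
  assumes "open S" "\<And>y. y \<in> S \<Longrightarrow> f y = g y" "Ck_on k S f"
  shows "Ck_on k S g"
  using assms(2,3)
proof (induction k arbitrary: f g)
  case 0
  then show ?case
    by (simp add: continuous_on_cong[of S S f g])
next
  case (Suc k)
  have "g differentiable (at x)" if "x \<in> S" for x
    using differentiable_cong_open[OF assms(1) that, of f g] Suc.prems that by auto
  moreover have "Ck_on k S (\<lambda>x. frechet_derivative g (at x) v)" for v
    by (rule Suc.IH[of "\<lambda>x. frechet_derivative f (at x) v"])
      (use Suc.prems in \<open>auto simp: frechet_derivative_cong_open[OF assms(1) _ Suc.prems(1)]\<close>)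
  ultimately show ?case
    by auto
qed

lemma Ck_on_subset: "Ck_on k S f \<Longrightarrow> T \<subseteq> S \<Longrightarrow> Ck_on k T f"
  by (induction k arbitrary: f) (auto intro: continuous_on_subset)

lemma Ck_on_local:
  assumes "\<And>x. x \<in> S \<Longrightarrow> \<exists>T. open T \<and> x \<in> T \<and> Ck_on k T f"
  shows "Ck_on k S f"
  using assms
proof (induction k arbitrary: f)
  case 0
  have "isCont f x" if "x \<in> S" for x
    using 0[OF that] by (auto simp: continuous_on_eq_continuous_at)
  then show ?case
    by (simp add: continuous_at_imp_continuous_on)
next
  case (Suc k)
  have "f differentiable (at x)" if "x \<in> S" for x
    using Suc.prems[OF that] by auto
  moreover have "Ck_on k S (\<lambda>x. frechet_derivative f (at x) v)" for v
  proof (rule Suc.IH)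
    fix x
    assume "x \<in> S"
    then obtain T where "open T" "x \<in> T" "Ck_on (Suc k) T f"
      using Suc.prems by blast
    then show "\<exists>T. open T \<and> x \<in> T \<and> Ck_on k T (\<lambda>x. frechet_derivative f (at x) v)"
      by (intro exI[of _ T]) simp
  qed
  ultimately show ?case
    by auto
qed

lemma Ck_on_SucD: "Ck_on (Suc k) S f \<Longrightarrow> Ck_on k S f"
proof (induction k arbitrary: f)
  case 0
  then show ?case
    by (auto intro!: continuous_at_imp_continuous_on differentiable_imp_continuous_within)
next
  case (Suc k)
  have "Ck_on k S (\<lambda>x. frechet_derivative f (at x) v)" for v
    by (rule Suc.IH) (use Suc.prems in simp)
  then show ?case
    using Suc.prems by simp
qed

lemma Ck_on_const: "Ck_on k S (\<lambda>x. c)"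
  by (induction k arbitrary: c) (auto simp: frechet_derivative_const)

text \<open>With \<open>Ck_on_SucE\<close> this reduces each closure property below to a rule for derivatives and an induction
  on \<open>k\<close>.\<close>

lemma Ck_on_SucI:
  assumes "open S" "\<And>x. x \<in> S \<Longrightarrow> (f has_derivative f' x) (at x)"
    "\<And>v. Ck_on k S (\<lambda>x. f' x v)"
  shows "Ck_on (Suc k) S f"
proof -
  have eq: "f' x v = frechet_derivative f (at x) v" if "x \<in> S" for x v
    using frechet_derivative_at[OF assms(2)[OF that]] by simp
  have "Ck_on k S (\<lambda>x. frechet_derivative f (at x) v)" for v
    using Ck_on_cong[OF assms(1) _ assms(3)[of v]] eq by simp
  moreover have "f differentiable (at x)" if "x \<in> S" for x
    using assms(2)[OF that] by (auto simp: differentiable_def)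
  ultimately show ?thesis
    by simp
qed

lemma Ck_on_SucE:
  assumes "Ck_on (Suc k) S f"
  shows "\<And>x. x \<in> S \<Longrightarrow> (f has_derivative frechet_derivative f (at x)) (at x)"
    and "\<And>v. Ck_on k S (\<lambda>x. frechet_derivative f (at x) v)"
  using assms frechet_derivative_works by auto

lemma Ck_on_linear:
  assumes "open S" "bounded_linear L" "Ck_on k S f"
  shows "Ck_on k S (\<lambda>x. L (f x))"
  using assms(3)
proof (induction k arbitrary: f)
  case 0
  then show ?case
    by (simp add: bounded_linear.continuous_on[OF assms(2)])
next
  case (Suc k)
  show ?case
    by (rule Ck_on_SucI[OF assms(1) bounded_linear.has_derivative[OF assms(2) Ck_on_SucE(1)[OF Suc.prems]]])
      (auto intro: Suc.IH Ck_on_SucE(2)[OF Suc.prems])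
qed

lemma Ck_on_add:
  assumes "open S" "Ck_on k S f" "Ck_on k S g"
  shows "Ck_on k S (\<lambda>x. f x + g x)"
  using assms(2,3)
proof (induction k arbitrary: f g)
  case 0
  then show ?case
    by (simp add: continuous_on_add)
next
  case (Suc k)
  show ?case
    by (rule Ck_on_SucI[OF assms(1) has_derivative_add[OF Ck_on_SucE(1)[OF Suc.prems(1)]
            Ck_on_SucE(1)[OF Suc.prems(2)]]])
      (auto intro: Suc.IH Ck_on_SucE(2)[OF Suc.prems(1)] Ck_on_SucE(2)[OF Suc.prems(2)])
qed

lemma Ck_on_bilinear:
  assumes "open S" "bounded_bilinear B" "Ck_on k S f" "Ck_on k S g"
  shows "Ck_on k S (\<lambda>x. B (f x) (g x))"
  using assms(3,4)
proof (induction k arbitrary: f g)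
  case 0
  then show ?case
    by (simp add: bounded_bilinear.continuous_on[OF assms(2)])
next
  case (Suc k)
  note f = Ck_on_SucE[OF Suc.prems(1)] Ck_on_SucD[OF Suc.prems(1)]
  note g = Ck_on_SucE[OF Suc.prems(2)] Ck_on_SucD[OF Suc.prems(2)]
  show ?case
    by (rule Ck_on_SucI[OF assms(1) bounded_bilinear.FDERIV[OF assms(2) f(1) g(1)]])
      (auto intro!: Ck_on_add[OF assms(1)] Suc.IH f g)
qed

lemma Ck_on_inverse:
  fixes f :: "'a::real_normed_vector \<Rightarrow> 'b::real_normed_field"
  assumes "open S" "\<And>x. x \<in> S \<Longrightarrow> f x \<noteq> 0" "Ck_on k S f"
  shows "Ck_on k S (\<lambda>x. inverse (f x))"
  using assms(3)
proof (induction k)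
  case 0
  then show ?case
    by (simp add: assms(2) continuous_on_inverse)
next
  case (Suc k)
  note f = Ck_on_SucE[OF Suc.prems] Ck_on_SucD[OF Suc.prems]
  note mult = Ck_on_bilinear[OF assms(1) bounded_bilinear_mult]
  have "Ck_on k S (\<lambda>x. - (inverse (f x) * frechet_derivative f (at x) v * inverse (f x)))" for v
    by (intro Ck_on_linear[OF assms(1) bounded_linear_minus[OF bounded_linear_ident]] mult
        Suc.IH f)
  then show ?case
    by (intro Ck_on_SucI[OF assms(1) Deriv.has_derivative_inverse[OF assms(2) f(1)]]) auto
qed

lemma Ck_on_compose_real:
  fixes \<phi> :: "real \<Rightarrow> real"
  assumes "open S" "Ck_on k UNIV \<phi>" "Ck_on k S f"
  shows "Ck_on k S (\<lambda>x. \<phi> (f x))"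
  using assms(2,3)
proof (induction k arbitrary: \<phi> f)
  case 0
  then show ?case
    using continuous_on_compose2[of UNIV \<phi> S f] by simp
next
  case (Suc k)
  note p = Ck_on_SucE[OF Suc.prems(1)]
  note f = Ck_on_SucE[OF Suc.prems(2)] Ck_on_SucD[OF Suc.prems(2)]
  have lin: "frechet_derivative \<phi> (at t) u = u * frechet_derivative \<phi> (at t) 1" for t u
    using linear_scale[OF has_derivative_linear[OF p(1)], of t u 1] by simp
  have "Ck_on k S (\<lambda>x. frechet_derivative f (at x) v * frechet_derivative \<phi> (at (f x)) 1)" for v
    using Suc.IH[OF p(2) f(3)] f(2) by (rule Ck_on_bilinear[OF assms(1) bounded_bilinear_mult, rotated])
  then have "Ck_on k S (\<lambda>x. frechet_derivative \<phi> (at (f x)) (frechet_derivative f (at x) v))" for v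
    by (simp only: lin[of "f x" "frechet_derivative f (at x) v" for x])
  then show ?case
    by (intro Ck_on_SucI[OF assms(1) has_derivative_compose[OF f(1) p(1)]]) auto
qed


section \<open>Smooth cutoff functions of one real variable\<close>

text \<open>The functions \<open>t\<^sup>-\<^sup>n e\<^sup>-\<^sup>1\<^sup>/\<^sup>t\<close>, extended by zero to \<open>t \<le> 0\<close>.  The linear span of this family is closed under
  differentiation, so all its members are smooth.\<close>

definition flat_exp :: "nat \<Rightarrow> real \<Rightarrow> real" where
  "flat_exp n t = (if 0 < t then inverse t ^ n / exp (inverse t) else 0)"

lemma flat_exp_tendsto_0: "(flat_exp n \<longlongrightarrow> 0) (at_right 0)"
proof -
  have "((\<lambda>t. inverse t ^ n / exp (inverse t)) \<longlongrightarrow> (0::real)) (at_right 0)"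
    by (rule filterlim_compose[OF tendsto_power_div_exp_0 filterlim_inverse_at_top_right])
  then show ?thesis
    by (rule Lim_transform_eventually) (auto simp: eventually_at_filter flat_exp_def)
qed

lemma flat_exp_deriv:
  "(flat_exp n has_real_derivative flat_exp (n + 2) t - of_nat n * flat_exp (Suc n) t) (at t)"
proof (cases t "0 :: real" rule: linorder_cases)
  case less
  have "((\<lambda>_. 0) has_real_derivative 0) (at t)"
    by simp
  then have "(flat_exp n has_real_derivative 0) (at t)"
    by (rule has_field_derivative_transform_within_open[where S="{..<0}"])
      (use less in \<open>auto simp: flat_exp_def\<close>)
  then show ?thesis
    using less by (simp add: flat_exp_def)
next
  case equal
  have "((\<lambda>u. (flat_exp n u - flat_exp n 0) / (u - 0)) \<longlongrightarrow> 0) (at 0)"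
  proof (rule filterlim_split_at)
    have "((\<lambda>u. 0) \<longlongrightarrow> (0::real)) (at_left 0)"
      by simp
    then show "((\<lambda>u. (flat_exp n u - flat_exp n 0) / (u - 0)) \<longlongrightarrow> 0) (at_left 0)"
      by (rule Lim_transform_eventually) (auto simp: eventually_at_filter flat_exp_def)
    show "((\<lambda>u. (flat_exp n u - flat_exp n 0) / (u - 0)) \<longlongrightarrow> 0) (at_right 0)"
      by (rule Lim_transform_eventually[OF flat_exp_tendsto_0[of "Suc n"]])
        (auto simp: eventually_at_filter flat_exp_def divide_simps)
  qed
  then show ?thesis
    using equal by (simp add: has_field_derivative_iff flat_exp_def)
next
  case greater
  define u where "u = inverse t"
  \<comment> \<open>Differentiate \<open>u\<^sup>n e\<^sup>-\<^sup>u\<close> at \<open>u = 1/t\<close>.\<close>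
  have inv: "(inverse has_real_derivative - (u * u)) (at t)"
    using greater by (auto intro!: derivative_eq_intros simp: u_def)
  have "((\<lambda>u. u ^ n * exp (- u)) has_real_derivative
      of_nat n * u ^ (n - 1) * exp (- u) - u ^ n * exp (- u)) (at (inverse t))"
    unfolding u_def by (auto intro!: derivative_eq_intros)
  from DERIV_chain2[OF this inv]
  have "((\<lambda>t. inverse t ^ n / exp (inverse t)) has_real_derivative
      (of_nat n * u ^ (n - 1) * exp (- u) - u ^ n * exp (- u)) * - (u * u)) (at t)"
    by (simp add: exp_minus divide_inverse)
  also have "(of_nat n * u ^ (n - 1) * exp (- u) - u ^ n * exp (- u)) * - (u * u)
      = flat_exp (n + 2) t - of_nat n * flat_exp (Suc n) t"
    using greater
    by (cases n) (simp_all add: flat_exp_def u_def[symmetric] exp_minus divide_inverse algebra_simps)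
  finally have "((\<lambda>t. inverse t ^ n / exp (inverse t)) has_real_derivative
      flat_exp (n + 2) t - of_nat n * flat_exp (Suc n) t) (at t)" .
  then show ?thesis
    by (rule has_field_derivative_transform_within_open[where S="{0<..}"])
      (use greater in \<open>auto simp: flat_exp_def\<close>)
qed

lemma Ck_on_flat_exp: "Ck_on k UNIV (flat_exp n)"
proof (induction k arbitrary: n)
  case 0
  then show ?case
    by (auto intro!: continuous_at_imp_continuous_on DERIV_isCont flat_exp_deriv)
next
  case (Suc k)
  have "Ck_on k UNIV (\<lambda>t. (flat_exp (n + 2) t + (- of_nat n) * flat_exp (Suc n) t) * v)" for v
    by (intro Ck_on_bilinear[OF open_UNIV bounded_bilinear_mult] Ck_on_add[OF open_UNIV]
        Ck_on_const Suc.IH)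
  then show ?case
    by (intro Ck_on_SucI[OF open_UNIV flat_exp_deriv[unfolded has_field_derivative_def]]) simp
qed

text \<open>A smooth function that is \<open>1\<close> on \<open>t \<le> 1\<close> and \<open>0\<close> on \<open>t \<ge> 2\<close>.\<close>

definition cutoff :: "real \<Rightarrow> real" where
  "cutoff t = flat_exp 0 (2 - t) * inverse (flat_exp 0 (2 - t) + flat_exp 0 (t - 1))"

lemma Ck_on_cutoff: "Ck_on k UNIV cutoff"
proof -
  have l: "Ck_on k UNIV (\<lambda>t::real. 2 + - t)" "Ck_on k UNIV (\<lambda>t::real. t + (-1))"
  proof -
    have "Ck_on k UNIV (\<lambda>t::real. t)"
      by (cases k) (auto intro!: Ck_on_SucI[OF _ has_derivative_ident] Ck_on_const simp del: Ck_on.simps(2))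
    then show "Ck_on k UNIV (\<lambda>t::real. 2 + - t)" "Ck_on k UNIV (\<lambda>t::real. t + (-1))"
      using Ck_on_add[OF open_UNIV Ck_on_const]
        Ck_on_add[OF open_UNIV _ Ck_on_const]
        Ck_on_linear[OF open_UNIV bounded_linear_minus[OF bounded_linear_ident]] by blast+
  qed
  have "0 < flat_exp 0 (2 - t) + flat_exp 0 (t - 1)" for t
    by (cases "t < 2") (auto simp: flat_exp_def intro: add_pos_pos add_pos_nonneg)
  then have "flat_exp 0 (2 - t) + flat_exp 0 (t - 1) \<noteq> 0" for t
    by (simp add: less_imp_neq[symmetric])
  then show ?thesis
    unfolding cutoff_def[abs_def]
    by (intro Ck_on_bilinear[OF open_UNIV bounded_bilinear_mult] Ck_on_inverse[OF open_UNIV]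
        Ck_on_add[OF open_UNIV] Ck_on_compose_real[OF open_UNIV Ck_on_flat_exp])
      (use l in simp_all)
qed

lemma cutoff_eq_1: "t \<le> 1 \<Longrightarrow> cutoff t = 1"
  by (auto simp: cutoff_def flat_exp_def)

lemma cutoff_eq_0: "2 \<le> t \<Longrightarrow> cutoff t = 0"
  by (auto simp: cutoff_def flat_exp_def)


section \<open>Smooth maps on a complex manifold\<close>

locale complex_mfd =
  fixes A :: "('m::{t2_space,second_countable_topology}, 'n::finite) chart set"
  assumes manifold: "complex_manifold A"
begin

lemma ex_chart: "\<exists>c\<in>A. x \<in> fst c"
proof -
  have "x \<in> (\<Union>c\<in>A. fst c)"
    using manifold by (simp add: complex_manifold_def)
  then show ?thesis
    by blast
qed

lemma open_chart: "c \<in> A \<Longrightarrow> open (fst c)"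
  using manifold by (simp add: complex_manifold_def)

lemma chart_homeomorphism:
  "c \<in> A \<Longrightarrow> homeomorphism (fst c) (snd c ` fst c) (snd c) (chart_inv c)"
  using manifold by (simp add: complex_manifold_def)

lemma chart_inv_chart: "c \<in> A \<Longrightarrow> x \<in> fst c \<Longrightarrow> chart_inv c (snd c x) = x"
  using homeomorphism_apply1[OF chart_homeomorphism] .

lemma open_chart_image:
  assumes "c \<in> A" "open U"
  shows "open (snd c ` (U \<inter> fst c))"
proof -
  have "openin (top_of_set (fst c)) (U \<inter> fst c)"
    using openin_open_Int[OF assms(2), of "fst c"] by (simp add: Int_commute)
  then have "openin (top_of_set (snd c ` fst c)) (snd c ` (U \<inter> fst c))"
    using homeomorphism_imp_open_map[OF chart_homeomorphism[OF assms(1)]] by blast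
  moreover have "open (snd c ` fst c)"
    using manifold assms(1) by (simp add: complex_manifold_def)
  ultimately show ?thesis
    by (simp add: openin_open_eq)
qed

lemma smooth_map_Ck:
  "smooth_map A U f \<longleftrightarrow>
    (\<forall>c\<in>A. \<forall>k. Ck_on k (snd c ` (U \<inter> fst c)) (\<lambda>z. f (chart_inv c z)))"
  by (simp add: smooth_map_def smooth_on_def o_def)

lemma smooth_map_subset: "smooth_map A U f \<Longrightarrow> V \<subseteq> U \<Longrightarrow> smooth_map A V f"
  unfolding smooth_map_Ck by (meson Ck_on_subset Int_mono image_mono order_refl)

lemma smooth_map_cong:
  assumes "open U" "\<And>x. x \<in> U \<Longrightarrow> f x = g x" "smooth_map A U f"
  shows "smooth_map A U g"
  unfolding smooth_map_Ck
proof (intro ballI allI)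
  fix c k
  assume c: "c \<in> A"
  show "Ck_on k (snd c ` (U \<inter> fst c)) (\<lambda>z. g (chart_inv c z))"
    by (rule Ck_on_cong[OF open_chart_image[OF c assms(1)], of "\<lambda>z. f (chart_inv c z)"])
      (use assms(2,3) c in \<open>auto simp: chart_inv_chart smooth_map_Ck\<close>)
qed

lemma smooth_map_local:
  assumes "\<And>x. x \<in> U \<Longrightarrow> \<exists>N. open N \<and> x \<in> N \<and> smooth_map A N f"
  shows "smooth_map A U f"
  unfolding smooth_map_Ck
proof (intro ballI allI)
  fix c k
  assume c: "c \<in> A"
  show "Ck_on k (snd c ` (U \<inter> fst c)) (\<lambda>z. f (chart_inv c z))"
  proof (rule Ck_on_local)
    fix z
    assume "z \<in> snd c ` (U \<inter> fst c)"
    then obtain x where x: "x \<in> U" "x \<in> fst c" "z = snd c x"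
      by blast
    then obtain N where "open N" "x \<in> N" "smooth_map A N f"
      using assms by blast
    then show "\<exists>T. open T \<and> z \<in> T \<and> Ck_on k T (\<lambda>z. f (chart_inv c z))"
      using x c open_chart_image[OF c]
      by (intro exI[of _ "snd c ` (N \<inter> fst c)"]) (auto simp: smooth_map_Ck)
  qed
qed

lemma smooth_map_const: "smooth_map A U (\<lambda>_. a)"
  by (simp add: smooth_map_Ck Ck_on_const)

lemma smooth_map_linear:
  assumes "open U" "bounded_linear L" "smooth_map A U f"
  shows "smooth_map A U (\<lambda>x. L (f x))"
  using assms(3) Ck_on_linear[OF open_chart_image[OF _ assms(1)] assms(2)]
  unfolding smooth_map_Ck by blast

lemma smooth_map_add:
  assumes "open U" "smooth_map A U f" "smooth_map A U g"
  shows "smooth_map A U (\<lambda>x. f x + g x)"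
  using assms(2,3) Ck_on_add[OF open_chart_image[OF _ assms(1)]]
  unfolding smooth_map_Ck by blast

lemma smooth_map_diff:
  "open U \<Longrightarrow> smooth_map A U f \<Longrightarrow> smooth_map A U g \<Longrightarrow> smooth_map A U (\<lambda>x. f x - g x)"
  using smooth_map_add[of U f "\<lambda>x. - g x"]
    smooth_map_linear[OF _ bounded_linear_minus[OF bounded_linear_ident], of U g] by simp

lemma smooth_map_bilinear:
  assumes "open U" "bounded_bilinear B" "smooth_map A U f" "smooth_map A U g"
  shows "smooth_map A U (\<lambda>x. B (f x) (g x))"
  using assms(3,4) Ck_on_bilinear[OF open_chart_image[OF _ assms(1)] assms(2)]
  unfolding smooth_map_Ck by blast

lemmas smooth_map_mult = smooth_map_bilinear[OF _ bounded_bilinear_mult]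

lemma smooth_map_sum:
  "open U \<Longrightarrow> (\<And>i. i \<in> I \<Longrightarrow> smooth_map A U (f i)) \<Longrightarrow> smooth_map A U (\<lambda>x. \<Sum>i\<in>I. f i x)"
  by (induction I rule: infinite_finite_induct) (auto simp: smooth_map_const smooth_map_add)

lemma smooth_map_inverse:
  fixes f :: "'m \<Rightarrow> 'b::real_normed_field"
  assumes "open U" "\<And>x. x \<in> U \<Longrightarrow> f x \<noteq> 0" "smooth_map A U f"
  shows "smooth_map A U (\<lambda>x. inverse (f x))"
  unfolding smooth_map_Ck
proof (intro ballI allI)
  fix c k
  assume c: "c \<in> A"
  show "Ck_on k (snd c ` (U \<inter> fst c)) (\<lambda>z. inverse (f (chart_inv c z)))"
    by (rule Ck_on_inverse[OF open_chart_image[OF c assms(1)]])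
      (use assms c in \<open>auto simp: chart_inv_chart[OF c] smooth_map_Ck\<close>)
qed

lemma smooth_map_cutoff:
  assumes "open U" "smooth_map A U f"
  shows "smooth_map A U (\<lambda>x. cutoff (f x))"
  using assms(2) Ck_on_compose_real[OF open_chart_image[OF _ assms(1)] Ck_on_cutoff]
  unfolding smooth_map_Ck by blast

lemma smooth_map_vec_iff:
  fixes f :: "'m \<Rightarrow> complex^'r::finite"
  assumes "open U"
  shows "smooth_map A U f \<longleftrightarrow> (\<forall>j. smooth_map A U (\<lambda>x. f x $ j))"
proof
  assume "smooth_map A U f"
  then show "\<forall>j. smooth_map A U (\<lambda>x. f x $ j)"
    using smooth_map_linear[OF assms bounded_linear_vec_nth] by blast
next
  assume *: "\<forall>j. smooth_map A U (\<lambda>x. f x $ j)"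
  have ax: "bounded_linear (axis j :: complex \<Rightarrow> complex^'r)" for j
    by (simp add: linear_conv_bounded_linear[symmetric] linear_iff axis_def vec_eq_iff)
  have "smooth_map A U (\<lambda>x. \<Sum>j\<in>UNIV. axis j (f x $ j))"
    by (rule smooth_map_sum[OF assms], rule smooth_map_linear[OF assms ax]) (use * in blast)
  moreover have "(\<Sum>j\<in>UNIV. axis j (f x $ j)) = f x" for x
    by (simp add: vec_eq_iff axis_def if_distrib cong: if_cong)
  ultimately show "smooth_map A U f"
    by simp
qed

lemma smooth_map_continuous_on:
  assumes "open U" "smooth_map A U f"
  shows "continuous_on U f"
proof (rule continuous_at_imp_continuous_on, rule ballI)
  fix x
  assume x: "x \<in> U"
  obtain c where c: "c \<in> A" "x \<in> fst c"
    using ex_chart by blast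
  have "continuous_on (snd c ` (U \<inter> fst c)) (\<lambda>z. f (chart_inv c z))"
    using assms(2) c Ck_on.simps(1) unfolding smooth_map_Ck by blast
  moreover have "continuous_on (U \<inter> fst c) (snd c)"
    using homeomorphism_cont1[OF chart_homeomorphism[OF c(1)]] by (rule continuous_on_subset) auto
  ultimately have "continuous_on (U \<inter> fst c) (\<lambda>x. f (chart_inv c (snd c x)))"
    by (rule continuous_on_compose2) auto
  then have "continuous_on (U \<inter> fst c) f"
    by (rule continuous_on_eq) (simp add: chart_inv_chart c)
  then show "isCont f x"
    using x c open_Int[OF assms(1) open_chart[OF c(1)]] by (simp add: continuous_on_eq_continuous_at)
qed

lemma smooth_map_chart:
  assumes "c \<in> A"
  shows "smooth_map A (fst c) (snd c)"
proof -
  have "holomorphic_map A (fst c) (\<lambda>x. snd c x $ i)" for i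
    using manifold assms by (simp add: complex_manifold_def)
  then have "smooth_map A (fst c) (\<lambda>x. snd c x $ i)" for i
    by (auto simp: holomorphic_map_def holomorphic_fun_on_def smooth_map_def)
  then show ?thesis
    by (simp add: smooth_map_vec_iff[OF open_chart[OF assms]])
qed

text \<open>The function is \<open>1\<close> on a neighbourhood \<open>N\<close> of \<open>x\<close> and vanishes outside the closed subset \<open>K\<close> of \<open>W\<close>.
  In a chart it is the cutoff of the squared distance; \<open>K\<close> is the preimage of a closed coordinate
  ball, which is closed because it is compact and the manifold is Hausdorff.\<close>

lemma ex_bump:
  assumes "open W" "x \<in> W"
  obtains \<beta> :: "'m \<Rightarrow> real" and K N where "smooth_map A UNIV \<beta>" "closed K" "K \<subseteq> W"
    "\<And>y. y \<notin> K \<Longrightarrow> \<beta> y = 0" "open N" "x \<in> N" "N \<subseteq> W" "\<And>y. y \<in> N \<Longrightarrow> \<beta> y = 1"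
proof -
  obtain c where c: "c \<in> A" "x \<in> fst c"
    using ex_chart by blast
  define z0 where "z0 = snd c x"
  obtain e where e: "0 < e" "cball z0 e \<subseteq> snd c ` (W \<inter> fst c)"
    using open_chart_image[OF c(1) assms(1)] assms(2) c(2)
    unfolding open_contains_cball z0_def by blast
  \<comment> \<open>Then \<open>r y / d \<ge> 2\<close> exactly when the coordinates of \<open>y\<close> have distance at least \<open>e\<close> from \<open>z0\<close>.\<close>
  define d where "d = e\<^sup>2 / 2"
  have d: "0 < d"
    using e by (simp add: d_def)
  define r where "r y = inner (snd c y - z0) (snd c y - z0)" for y
  have r: "r y = (dist z0 (snd c y))\<^sup>2" for y
    by (subst dist_commute) (simp add: r_def dist_norm power2_norm_eq_inner)
  have sr: "smooth_map A (fst c) r"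
    unfolding r_def using c
    by (intro smooth_map_bilinear[OF _ bounded_bilinear_inner] smooth_map_diff smooth_map_const
        open_chart smooth_map_chart)
  define \<beta> where "\<beta> y = (if y \<in> fst c then cutoff (r y * inverse d) else 0)" for y
  define K where "K = chart_inv c ` cball z0 e"
  define N where "N = (r -` {..<d} \<inter> fst c) \<inter> W"
  have "continuous_on (cball z0 e) (chart_inv c)"
    using homeomorphism_cont2[OF chart_homeomorphism[OF c(1)]] e(2)
    by (meson Int_lower2 continuous_on_subset image_mono order_trans)
  then have K: "closed K"
    unfolding K_def by (intro compact_imp_closed compact_continuous_image compact_cball)
  have KW: "K \<subseteq> W"
    using e(2) chart_inv_chart[OF c(1)] unfolding K_def by (fastforce simp: subset_iff image_iff)
  have off: "\<beta> y = 0" if "y \<notin> K" for y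
  proof (cases "y \<in> fst c")
    case True
    have "snd c y \<notin> cball z0 e"
      using that chart_inv_chart[OF c(1) True] unfolding K_def by (metis imageI)
    then have "e\<^sup>2 \<le> r y"
      using e(1) by (auto simp: r intro!: power_mono)
    then have "2 \<le> r y * inverse d"
      using e(1) by (simp add: d_def field_simps)
    then show ?thesis
      by (simp add: \<beta>_def cutoff_eq_0)
  qed (simp add: \<beta>_def)
  have "smooth_map A UNIV \<beta>"
  proof (rule smooth_map_local)
    fix y
    show "\<exists>N. open N \<and> y \<in> N \<and> smooth_map A N \<beta>"
    proof (cases "y \<in> K")
      case False
      have "smooth_map A (- K) \<beta>"
        by (rule smooth_map_cong[OF _ _ smooth_map_const[of _ 0]]) (use K off in auto)
      then show ?thesis
        using False K by (intro exI[of _ "- K"]) auto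
    next
      case True
      then have y: "y \<in> fst c"
        using e(2) chart_inv_chart[OF c(1)] unfolding K_def by (fastforce simp: subset_iff image_iff)
      have "smooth_map A (fst c) \<beta>"
        by (rule smooth_map_cong[of _ "\<lambda>y. cutoff (r y * inverse d)"])
          (use c in \<open>auto simp: \<beta>_def intro!: smooth_map_cutoff smooth_map_mult smooth_map_const
              open_chart sr\<close>)
      then show ?thesis
        using y c open_chart by blast
    qed
  qed
  moreover have "open N"
    unfolding N_def using smooth_map_continuous_on[OF open_chart[OF c(1)] sr] assms(1)
    by (simp add: continuous_on_open_vimage[OF open_chart[OF c(1)]] open_Int)
  moreover have "x \<in> N"
    using c d assms by (simp add: N_def r z0_def)
  moreover have "\<beta> y = 1" if "y \<in> N" for y
    using that d by (auto simp: N_def \<beta>_def field_simps intro!: cutoff_eq_1)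
  ultimately show thesis
    using that[of \<beta> K N] K KW off by (auto simp: N_def)
qed

end


section \<open>Finite families of vectors\<close>

text \<open>The span of the first \<open>k\<close> vectors of a sequence.\<close>

definition span_of :: "nat \<Rightarrow> (nat \<Rightarrow> complex^'r::finite) \<Rightarrow> (complex^'r) set" where
  "span_of k f = {\<Sum>i<k. a i *s f i | a. True}"

text \<open>Linear independence of the first \<open>k\<close> vectors of a sequence, as a family.\<close>

definition indep_family :: "nat \<Rightarrow> (nat \<Rightarrow> complex^'r::finite) \<Rightarrow> bool" where
  "indep_family k f \<longleftrightarrow> (\<forall>a. (\<Sum>i<k. a i *s f i) = 0 \<longrightarrow> (\<forall>i<k. a i = 0))"

text \<open>The first \<open>k\<close> vectors are in reduced form with respect to the pivot coordinates \<open>p 0, \<dots>, p (k - 1)\<close>: the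
  pivot columns form an identity matrix.\<close>

definition normalized :: "nat \<Rightarrow> (nat \<Rightarrow> 'r) \<Rightarrow> (nat \<Rightarrow> complex^'r::finite) \<Rightarrow> bool" where
  "normalized k p f \<longleftrightarrow> (\<forall>i<k. \<forall>l<k. f i $ p l = (if i = l then 1 else 0))"

lemma span_of_sum: "(\<Sum>i<k. a i *s f i) \<in> span_of k f"
  unfolding span_of_def by (rule CollectI, rule exI[of _ a]) simp

lemma span_of_eq_span: "span_of k f = vec.span (f ` {..<k})"
proof
  show "span_of k f \<subseteq> vec.span (f ` {..<k})"
    unfolding span_of_def by (auto intro: vec.span_sum vec.span_scale vec.span_base)
  show "vec.span (f ` {..<k}) \<subseteq> span_of k f"
  proof (rule vec.span_minimal)
    show "f ` {..<k} \<subseteq> span_of k f"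
    proof
      fix v
      assume "v \<in> f ` {..<k}"
      then obtain j where "j < k" "v = f j"
        by blast
      then have "v = (\<Sum>i<k. (if i = j then 1 else 0) *s f i)"
        by (simp add: if_distrib[of "\<lambda>a. a *s _"] cong: if_cong)
      also have "\<dots> \<in> span_of k f"
        by (rule span_of_sum)
      finally show "v \<in> span_of k f" .
    qed
    have "\<exists>c. (\<Sum>i<k. a i *s f i) + (\<Sum>i<k. b i *s f i) = (\<Sum>i<k. c i *s f i)" for a b
      by (rule exI[of _ "\<lambda>i. a i + b i"]) (simp add: sum.distrib vec.scale_left_distrib)
    moreover have "\<exists>c. z *s (\<Sum>i<k. a i *s f i) = (\<Sum>i<k. c i *s f i)" for z a
      by (rule exI[of _ "\<lambda>i. z * a i"]) (simp add: vec.scale_sum_right)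
    moreover have "\<exists>c. 0 = (\<Sum>i<k. c i *s f i)"
      by (rule exI[of _ "\<lambda>i. 0"]) simp
    ultimately show "vec.subspace (span_of k f)"
      unfolding span_of_def by (intro vec.subspaceI) auto
  qed
qed

lemma normalized_coord:
  assumes "normalized k p f" "l < k"
  shows "(\<Sum>i<k. a i *s f i) $ p l = a l"
proof -
  have "(\<Sum>i<k. a i *s f i) $ p l = (\<Sum>i<k. if i = l then a i else 0)"
    unfolding sum_component by (rule sum.cong) (use assms in \<open>auto simp: normalized_def\<close>)
  then show ?thesis
    using assms(2) by simp
qed

lemma normalized_indep: "normalized k p f \<Longrightarrow> indep_family k f"
  unfolding indep_family_def using normalized_coord by (metis zero_index)

lemma normalized_inj:
  assumes "normalized k p f"
  shows "inj_on p {..<k}"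
proof (rule inj_onI)
  fix i l
  assume "i \<in> {..<k}" "l \<in> {..<k}" "p i = p l"
  then show "i = l"
    using assms unfolding normalized_def by (metis lessThan_iff zero_neq_one)
qed

lemma normalized_span_coord:
  assumes "normalized k p f" "v \<in> span_of k f" "\<And>l. l < k \<Longrightarrow> v $ p l = 0"
  shows "v = 0"
proof -
  obtain a where a: "v = (\<Sum>i<k. a i *s f i)"
    using assms(2) unfolding span_of_def by blast
  have "a l = 0" if "l < k" for l
    using normalized_coord[OF assms(1) that, of a] assms(3)[OF that] a by simp
  then show ?thesis
    by (simp add: a)
qed

text \<open>If \<open>f\<close> is in reduced form with pivots \<open>p\<close>, the vector annihilated by \<open>f 0, \<dots>, f (k - 1)\<close> whose only
  nonzero non-pivot coordinate is a \<open>1\<close> at the non-pivot place \<open>j\<close>.\<close>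

definition kernel_basis ::
  "nat \<Rightarrow> (nat \<Rightarrow> 'r) \<Rightarrow> (nat \<Rightarrow> complex^'r::finite) \<Rightarrow> 'r \<Rightarrow> complex^'r" where
  "kernel_basis k p f j = axis j 1 - (\<Sum>l<k. (f l $ j) *s axis (p l) 1)"

text \<open>The complex bilinear pairing (no conjugation) of a vector with a row.\<close>

definition pairing :: "complex^'r::finite \<Rightarrow> complex^'r \<Rightarrow> complex" where
  "pairing v w = (\<Sum>j\<in>UNIV. v $ j * w $ j)"

lemma pairing_span:
  assumes "span_of k f = span_of k g"
  shows "(\<forall>i<k. pairing v (f i) = 0) \<longleftrightarrow> (\<forall>i<k. pairing v (g i) = 0)"
proof -
  have sub: "vec.subspace {w. pairing v w = 0}"
    by (rule vec.subspaceI)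
      (auto simp: pairing_def algebra_simps sum.distrib sum_distrib_left[symmetric])
  have "(\<forall>i<k. pairing v (f i) = 0) \<longleftrightarrow> span_of k f \<subseteq> {w. pairing v w = 0}" for f
    using vec.span_minimal[OF _ sub, of "f ` {..<k}"] vec.span_superset[of "f ` {..<k}"]
    unfolding span_of_eq_span by (auto simp: image_subset_iff)
  then show ?thesis
    using assms by simp
qed

lemma kernel_basis_coord:
  assumes "normalized k p f"
  shows "l < k \<Longrightarrow> j \<notin> p ` {..<k} \<Longrightarrow> kernel_basis k p f j $ p l = - f l $ j"
    and "j' \<notin> p ` {..<k} \<Longrightarrow> kernel_basis k p f j $ j' = (if j' = j then 1 else 0)"
proof -
  note inj = inj_onD[OF normalized_inj[OF assms]]
  have c: "(f m $ j) * (axis (p m) 1 $ p l) = (if m = l then f m $ j else 0)"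
    if "l < k" "m < k" for l m
    using inj[of m l] that by (auto simp: axis_def)
  show "kernel_basis k p f j $ p l = - f l $ j" if "l < k" "j \<notin> p ` {..<k}"
  proof -
    have "axis j 1 $ p l = (0 :: complex)"
      using that by (auto simp: axis_def)
    moreover have "(\<Sum>m<k. (f m $ j) * (axis (p m) 1 $ p l)) = (\<Sum>m<k. if m = l then f m $ j else 0)"
      by (rule sum.cong) (use c that in auto)
    ultimately show ?thesis
      using that by (simp add: kernel_basis_def sum_component)
  qed
  show "kernel_basis k p f j $ j' = (if j' = j then 1 else 0)" if "j' \<notin> p ` {..<k}"
  proof -
    have "(\<Sum>m<k. (f m $ j) * (axis (p m) 1 $ j')) = 0"
      by (rule sum.neutral) (use that in \<open>auto simp: axis_def\<close>)
    then show ?thesis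
      by (simp add: kernel_basis_def sum_component axis_def)
  qed
qed

text \<open>Here \<open>q\<close> enumerates the non-pivot coordinates.  They serve as pivots for the basis of the kernel.\<close>

lemma kernel_eq_span:
  fixes f :: "nat \<Rightarrow> complex^'r::finite"
  assumes n: "normalized k p f" and q: "bij_betw q {..<m} (- p ` {..<k})"
  shows "normalized m q (\<lambda>i. kernel_basis k p f (q i))"
    and "{v. \<forall>i<k. pairing v (f i) = 0} = span_of m (\<lambda>i. kernel_basis k p f (q i))"
proof -
  have q': "q i \<notin> p ` {..<k}" if "i < m" for i
    using q that by (auto simp: bij_betw_def)
  have qi: "i = l" if "i < m" "l < m" "q i = q l" for i l
    using q that by (auto simp: bij_betw_def inj_on_def)
  show norm: "normalized m q (\<lambda>i. kernel_basis k p f (q i))"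
    unfolding normalized_def using kernel_basis_coord(2)[OF n q'] qi by auto
  have pair: "pairing v (f i) = v $ p i + (\<Sum>l<m. v $ q l * f i $ q l)" if "i < k" for v i
  proof -
    have "pairing v (f i) = (\<Sum>j\<in>p ` {..<k}. v $ j * f i $ j) + (\<Sum>j\<in>- p ` {..<k}. v $ j * f i $ j)"
      unfolding pairing_def by (subst sum.union_disjoint[symmetric]) (auto intro: sum.cong)
    also have "(\<Sum>j\<in>p ` {..<k}. v $ j * f i $ j) = (\<Sum>l<k. v $ p l * f i $ p l)"
      by (simp add: sum.reindex[OF normalized_inj[OF n]])
    also have "\<dots> = (\<Sum>l<k. if l = i then v $ p l else 0)"
      by (rule sum.cong) (use n that in \<open>auto simp: normalized_def\<close>)
    also have "(\<Sum>j\<in>- p ` {..<k}. v $ j * f i $ j) = (\<Sum>l<m. v $ q l * f i $ q l)"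
      by (rule sum.reindex_bij_betw[OF q, symmetric])
    finally show ?thesis
      using that by simp
  qed
  show "{v. \<forall>i<k. pairing v (f i) = 0} = span_of m (\<lambda>i. kernel_basis k p f (q i))"
  proof (intro set_eqI iffI)
    fix v
    assume v: "v \<in> {v. \<forall>i<k. pairing v (f i) = 0}"
    have "v $ j = (\<Sum>l<m. v $ q l *s kernel_basis k p f (q l)) $ j" for j
    proof (cases "j \<in> p ` {..<k}")
      case True
      then obtain i where i: "i < k" "j = p i"
        by blast
      have "v $ j = (\<Sum>l<m. - (v $ q l * f i $ q l))"
        using v pair[OF i(1), of v] i by (simp add: sum_negf eq_neg_iff_add_eq_0)
      also have "\<dots> = (\<Sum>l<m. v $ q l *s kernel_basis k p f (q l)) $ j"
        unfolding sum_component by (rule sum.cong) (use i q' in \<open>auto simp: kernel_basis_coord(1)[OF n]\<close>)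
      finally show ?thesis .
    next
      case False
      then have "j \<in> q ` {..<m}"
        using q by (simp add: bij_betw_def)
      then obtain i where i: "i < m" "j = q i"
        by blast
      then show ?thesis
        using normalized_coord[OF norm i(1)] by simp
    qed
    then have "v = (\<Sum>l<m. v $ q l *s kernel_basis k p f (q l))"
      unfolding vec_eq_iff by (rule allI)
    also have "\<dots> \<in> span_of m (\<lambda>i. kernel_basis k p f (q i))"
      by (rule span_of_sum)
    finally show "v \<in> span_of m (\<lambda>i. kernel_basis k p f (q i))" .
  next
    fix v
    assume "v \<in> span_of m (\<lambda>i. kernel_basis k p f (q i))"
    then obtain a where a: "v = (\<Sum>l<m. a l *s kernel_basis k p f (q l))"
      unfolding span_of_def by blast
    have "pairing v (f i) = 0" if i: "i < k" for i
    proof -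
      have "v $ p i = (\<Sum>l<m. - (a l * f i $ q l))"
        unfolding a sum_component
        by (rule sum.cong) (use i q' in \<open>auto simp: kernel_basis_coord(1)[OF n]\<close>)
      moreover have "v $ q l = a l" if "l < m" for l
        unfolding a using normalized_coord[OF norm that] .
      ultimately show ?thesis
        by (simp add: pair[OF i] sum_negf)
    qed
    then show "v \<in> {v. \<forall>i<k. pairing v (f i) = 0}"
      by simp
  qed
qed


section \<open>Smooth row reduction\<close>

text \<open>One elimination step: \<open>e k\<close> is the new row, reduced by the earlier ones and rescaled, and is then used to
  clear its pivot column in the earlier rows.\<close>

lemma span_of_step:
  fixes a b :: "nat \<Rightarrow> complex^'r::finite"
  assumes ab: "span_of k b = span_of k a" and z: "z \<noteq> 0" and w: "w \<in> span_of k b"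
    and ek: "e k = z *s (a k - w)" and el: "\<And>l. l < k \<Longrightarrow> e l = b l - c l *s e k"
  shows "span_of (Suc k) e = span_of (Suc k) a"
proof -
  let ?A = "vec.span (a ` {..<Suc k})" and ?E = "vec.span (e ` {..<Suc k})"
  have sub: "span_of k f \<subseteq> vec.span (f ` {..<Suc k})" for f :: "nat \<Rightarrow> complex^'r"
    unfolding span_of_eq_span by (rule vec.span_mono) auto
  have bB: "b l \<in> span_of k b" if "l < k" for l
    unfolding span_of_eq_span using that by (auto intro: vec.span_base)
  have akA: "a k \<in> ?A" and ekE: "e k \<in> ?E"
    by (auto intro: vec.span_base)
  have ekA: "e k \<in> ?A"
    unfolding ek using akA w sub[of a] ab by (intro vec.span_scale vec.span_diff) auto
  have "e l \<in> ?A" if "l < Suc k" for l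
  proof (cases "l = k")
    case False
    then have "l < k"
      using that by simp
    then show ?thesis
      using el[of l] ekA bB[of l] sub[of a] ab by (auto intro!: vec.span_diff vec.span_scale)
  qed (use ekA in simp)
  then have "?E \<subseteq> ?A"
    by (intro vec.span_minimal) auto
  moreover have bE: "b l \<in> ?E" if "l < k" for l
  proof -
    have "b l = e l + c l *s e k"
      using el[OF that] by simp
    moreover have "e l \<in> ?E"
      using that by (intro vec.span_base) auto
    ultimately show ?thesis
      using ekE by (simp add: vec.span_add vec.span_scale)
  qed
  then have BE: "span_of k b \<subseteq> ?E"
    unfolding span_of_eq_span by (intro vec.span_minimal) auto
  have "a l \<in> ?E" if "l < Suc k" for l
  proof (cases "l = k")
    case True
    have "a k = inverse z *s e k + w"
      using z by (simp add: ek)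
    then show ?thesis
      using True ekE BE w by (auto intro!: vec.span_add vec.span_scale)
  next
    case False
    then have "a l \<in> span_of k a"
      using that unfolding span_of_eq_span by (auto intro!: vec.span_base)
    then show ?thesis
      using BE ab by auto
  qed
  then have "?A \<subseteq> ?E"
    by (intro vec.span_minimal) auto
  ultimately show ?thesis
    unfolding span_of_eq_span by blast
qed

lemma indep_family_SucD:
  assumes "indep_family (Suc k) f"
  shows "indep_family k f" "f k \<notin> span_of k f"
proof -
  have *: "\<forall>i<Suc k. a i = 0" if "(\<Sum>i<k. a i *s f i) + a k *s f k = 0" for a
    using assms that unfolding indep_family_def by simp
  show "indep_family k f"
    unfolding indep_family_def
  proof (intro allI impI)
    fix a i
    assume "(\<Sum>i<k. a i *s f i) = 0" "i < k"
    then have "\<forall>i<Suc k. (a(k := 0)) i = 0"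
      by (intro *) simp
    then have "(a(k := 0)) i = 0"
      using \<open>i < k\<close> less_SucI by blast
    then show "a i = 0"
      using \<open>i < k\<close> by simp
  qed
  show "f k \<notin> span_of k f"
  proof
    assume "f k \<in> span_of k f"
    then obtain a where "f k = (\<Sum>i<k. a i *s f i)"
      unfolding span_of_def by blast
    then show False
      using *[of "a(k := -1)"] by auto
  qed
qed

context complex_mfd
begin

text \<open>Gaussian elimination with parameters: all divisions are by a coordinate that is nonzero at the base
  point \<open>x\<close>, hence on a neighbourhood of it.\<close>

lemma smooth_row_reduction_ex:
  fixes a :: "nat \<Rightarrow> 'm \<Rightarrow> complex^'r::finite"
  assumes "open U" "x \<in> U" "\<forall>i<k. \<forall>j. smooth_map A U (\<lambda>y. a i y $ j)"
    "indep_family k (\<lambda>i. a i x)"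
  shows "\<exists>V p b. open V \<and> x \<in> V \<and> V \<subseteq> U \<and> (\<forall>i<k. \<forall>j. smooth_map A V (\<lambda>y. b i y $ j)) \<and>
    (\<forall>y\<in>V. normalized k p (\<lambda>i. b i y) \<and> span_of k (\<lambda>i. b i y) = span_of k (\<lambda>i. a i y))"
  using assms(3,4)
proof (induction k)
  case 0
  then show ?case
    using assms(1,2) by (intro exI[of _ U]) (auto simp: normalized_def span_of_def)
next
  case (Suc k)
  have "\<exists>V p b. open V \<and> x \<in> V \<and> V \<subseteq> U \<and>
      (\<forall>i<k. \<forall>j. smooth_map A V (\<lambda>y. b i y $ j)) \<and>
      (\<forall>y\<in>V. normalized k p (\<lambda>i. b i y) \<and> span_of k (\<lambda>i. b i y) = span_of k (\<lambda>i. a i y))"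
    by (rule Suc.IH[OF _ indep_family_SucD(1)[OF Suc.prems(2)]]) (simp add: Suc.prems(1))
  then obtain V p b where IH: "open V \<and> x \<in> V \<and> V \<subseteq> U \<and>
      (\<forall>i<k. \<forall>j. smooth_map A V (\<lambda>y. b i y $ j)) \<and>
      (\<forall>y\<in>V. normalized k p (\<lambda>i. b i y) \<and> span_of k (\<lambda>i. b i y) = span_of k (\<lambda>i. a i y))"
    by (elim exE) (rule that)
  then have V: "open V" "x \<in> V" "V \<subseteq> U"
    and sm: "\<And>i j. i < k \<Longrightarrow> smooth_map A V (\<lambda>y. b i y $ j)"
    and norm: "\<And>y. y \<in> V \<Longrightarrow> normalized k p (\<lambda>i. b i y)"
    and span: "\<And>y. y \<in> V \<Longrightarrow> span_of k (\<lambda>i. b i y) = span_of k (\<lambda>i. a i y)"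
    by blast+
  define w where "w y = (\<Sum>l<k. a k y $ p l *s b l y)" for y
  have w: "w y \<in> span_of k (\<lambda>i. b i y)" for y
    unfolding w_def by (rule span_of_sum)
  \<comment> \<open>The row \<open>a k\<close> after clearing the old pivot columns; it does not vanish at \<open>x\<close> by independence.\<close>
  define u where "u y = a k y - w y" for y
  have su: "smooth_map A V (\<lambda>y. u y $ j)" for j
  proof -
    have sa: "smooth_map A V (\<lambda>y. a k y $ i)" for i
      using Suc.prems(1) V(3) smooth_map_subset by blast
    have "smooth_map A V (\<lambda>y. a k y $ j - (\<Sum>l<k. a k y $ p l * b l y $ j))"
      using sa sm by (intro smooth_map_diff[OF V(1)] smooth_map_sum[OF V(1)] smooth_map_mult[OF V(1)]) auto
    then show ?thesis
      by (simp add: u_def w_def sum_component)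
  qed
  have up: "u y $ p l = 0" if "y \<in> V" "l < k" for y l
    using normalized_coord[OF norm[OF that(1)] that(2), of "\<lambda>l. a k y $ p l"]
    by (simp add: u_def w_def)
  have "u x \<noteq> 0"
    using w[of x] span[OF V(2)] indep_family_SucD(2)[OF Suc.prems(2)] by (auto simp: u_def)
  then obtain q where q: "u x $ q \<noteq> 0"
    by (auto simp: vec_eq_iff)
  define V' where "V' = (\<lambda>y. u y $ q) -` (- {0}) \<inter> V"
  have V': "open V'" "x \<in> V'" "V' \<subseteq> V" "\<And>y. y \<in> V' \<Longrightarrow> u y $ q \<noteq> 0"
    using smooth_map_continuous_on[OF V(1) su[of q]] V q
    by (auto simp: V'_def continuous_on_open_vimage)
  define e0 where "e0 y = inverse (u y $ q) *s u y" for y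
  define e where "e i y = (if i < k then b i y - b i y $ q *s e0 y else e0 y)" for i y
  have s0: "smooth_map A V' (\<lambda>y. e0 y $ j)" for j
    unfolding e0_def vector_smult_component using su V'
    by (intro smooth_map_mult[OF V'(1)] smooth_map_inverse[OF V'(1)])
      (auto intro: smooth_map_subset)
  have "smooth_map A V' (\<lambda>y. e i y $ j)" if "i < Suc k" for i j
  proof (cases "i < k")
    case True
    have "smooth_map A V' (\<lambda>y. b i y $ j - b i y $ q * e0 y $ j)"
      using sm[OF True] V' s0
      by (intro smooth_map_diff[OF V'(1)] smooth_map_mult[OF V'(1)]) (auto intro: smooth_map_subset)
    then show ?thesis
      using True by (simp add: e_def)
  next
    case False
    then show ?thesis
      using s0 by (simp add: e_def)
  qed
  moreover have "normalized (Suc k) (p(k := q)) (\<lambda>i. e i y)" if y: "y \<in> V'" for y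
  proof -
    have yV: "y \<in> V"
      using y V'(3) by auto
    have e0: "e0 y $ q = 1" "\<And>l. l < k \<Longrightarrow> e0 y $ p l = 0"
      using V'(4)[OF y] up[OF yV] by (simp_all add: e0_def)
    show ?thesis
      using norm[OF yV] e0 by (auto simp: normalized_def e_def less_Suc_eq)
  qed
  moreover have "span_of (Suc k) (\<lambda>i. e i y) = span_of (Suc k) (\<lambda>i. a i y)" if y: "y \<in> V'" for y
    by (rule span_of_step[of k "\<lambda>i. b i y" _ "inverse (u y $ q)" "w y" _ "\<lambda>l. b l y $ q"])
      (use span w V' y in \<open>auto simp: e_def e0_def u_def\<close>)
  ultimately show ?case
    using V V' by (intro exI[of _ V'] exI[of _ "p(k := q)"] exI[of _ e])
      (auto simp del: fun_upd_apply)
qed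

lemma smooth_row_reduction:
  fixes a :: "nat \<Rightarrow> 'm \<Rightarrow> complex^'r::finite"
  assumes "open U" "x \<in> U" "\<forall>i<k. \<forall>j. smooth_map A U (\<lambda>y. a i y $ j)"
    "indep_family k (\<lambda>i. a i x)"
  obtains V p b where "open V" "x \<in> V" "V \<subseteq> U"
    "\<And>i j. i < k \<Longrightarrow> smooth_map A V (\<lambda>y. b i y $ j)"
    "\<And>y. y \<in> V \<Longrightarrow> normalized k p (\<lambda>i. b i y)"
    "\<And>y. y \<in> V \<Longrightarrow> span_of k (\<lambda>i. b i y) = span_of k (\<lambda>i. a i y)"
proof -
  obtain V p b where "open V \<and> x \<in> V \<and> V \<subseteq> U \<and>
      (\<forall>i<k. \<forall>j. smooth_map A V (\<lambda>y. b i y $ j)) \<and>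
      (\<forall>y\<in>V. normalized k p (\<lambda>i. b i y) \<and> span_of k (\<lambda>i. b i y) = span_of k (\<lambda>i. a i y))"
    using smooth_row_reduction_ex[OF assms(1-4)] by (elim exE) (rule that)
  then show thesis
    by (intro that[of V b p]) blast+
qed

end


section \<open>The Cauchy-Riemann operator in charts\<close>

context complex_mfd
begin

lemma mdbar_cong:
  assumes "c \<in> A" "x \<in> fst c" "open N" "x \<in> N" "\<And>y. y \<in> N \<Longrightarrow> f y = g y"
  shows "mdbar f c x v = mdbar g c x v"
proof -
  have "frechet_derivative (f \<circ> chart_inv c) (at (snd c x))
      = frechet_derivative (g \<circ> chart_inv c) (at (snd c x))"
    by (rule frechet_derivative_cong_open[OF open_chart_image[OF assms(1,3)]])
      (use assms chart_inv_chart[OF assms(1)] in auto)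
  then show ?thesis
    by (simp add: mdbar_def mdiff_def)
qed

lemma mdiff_const: "mdiff (\<lambda>_. a) c x v = 0"
  by (simp add: mdiff_def o_def frechet_derivative_const)

lemma holomorphic_map_smooth: "holomorphic_map A U f \<Longrightarrow> smooth_map A U f"
  by (simp add: holomorphic_map_def holomorphic_fun_on_def smooth_map_def)

lemma holomorphic_mapI:
  assumes "smooth_map A U f"
    "\<And>c x v. c \<in> A \<Longrightarrow> x \<in> U \<Longrightarrow> x \<in> fst c \<Longrightarrow> mdbar f c x v = 0"
  shows "holomorphic_map A U f"
  unfolding holomorphic_map_def holomorphic_fun_on_def
proof (intro ballI conjI allI)
  fix c
  assume c: "c \<in> A"
  then show "smooth_on (snd c ` (U \<inter> fst c)) (f \<circ> chart_inv c)"
    using assms(1) unfolding smooth_map_def by (rule bspec[rotated])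
  fix z v
  assume "z \<in> snd c ` (U \<inter> fst c)"
  then obtain x where "x \<in> U" "x \<in> fst c" "z = snd c x"
    by (elim imageE IntE)
  then show "(frechet_derivative (f \<circ> chart_inv c) (at z) v
      + \<i> * frechet_derivative (f \<circ> chart_inv c) (at z) (\<i> *s v)) / 2 = 0"
    using assms(2)[OF c, of x v] by (simp only: mdbar_def mdiff_def)
qed

end


section \<open>Sections and subbundles in local trivializations\<close>

text \<open>The subset \<open>F\<close> of the total space meets every fibre in a linear subspace.  Local triviality is not required.\<close>

definition fibrewise_subspace :: "('e, 'm, 'r::finite) vbundle \<Rightarrow> 'e set \<Rightarrow> bool" where
  "fibrewise_subspace E F \<longleftrightarrow> (\<forall>x. bzero E x \<in> F \<and>
    (\<forall>e\<in>F \<inter> fib E x. \<forall>f\<in>F \<inter> fib E x. badd E e f \<in> F) \<and>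
    (\<forall>a. \<forall>e\<in>F \<inter> fib E x. bscale E a e \<in> F))"

lemma fibrewise_subspaceD:
  assumes "fibrewise_subspace E F"
  shows "bzero E x \<in> F"
    and "e \<in> F \<Longrightarrow> f \<in> F \<Longrightarrow> e \<in> fib E x \<Longrightarrow> f \<in> fib E x \<Longrightarrow> badd E e f \<in> F"
    and "e \<in> F \<Longrightarrow> e \<in> fib E x \<Longrightarrow> bscale E a e \<in> F"
  using assms unfolding fibrewise_subspace_def by (blast, blast, blast)

locale hol_bundle = complex_mfd A
  for A :: "('m::{t2_space,second_countable_topology}, 'n::finite) chart set" +
  fixes E :: "('e, 'm, 'r::finite) vbundle"
  assumes vbundle: "holomorphic_vbundle A E"
begin

lemma fib_closed:
  "bzero E x \<in> fib E x"
  "e \<in> fib E x \<Longrightarrow> f \<in> fib E x \<Longrightarrow> badd E e f \<in> fib E x"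
  "e \<in> fib E x \<Longrightarrow> bscale E a e \<in> fib E x"
  using vbundle by (simp_all add: holomorphic_vbundle_def)

lemma ex_triv: obtains U \<tau> where "(U, \<tau>) \<in> btriv E" "x \<in> U"
proof -
  have "x \<in> (\<Union>(U, \<tau>)\<in>btriv E. U)"
    using vbundle by (simp add: holomorphic_vbundle_def)
  then show thesis
    using that by blast
qed

lemma triv_all:
  assumes "(U, \<tau>) \<in> btriv E"
  shows "open U \<and> (\<forall>x\<in>U. bij_betw \<tau> (fib E x) UNIV \<and> \<tau> (bzero E x) = 0 \<and>
          (\<forall>e\<in>fib E x. \<forall>f\<in>fib E x. \<tau> (badd E e f) = \<tau> e + \<tau> f) \<and>
          (\<forall>a. \<forall>e\<in>fib E x. \<tau> (bscale E a e) = a *s \<tau> e))"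
proof -
  have "\<forall>(U, \<tau>)\<in>btriv E. open U \<and> (\<forall>x\<in>U. bij_betw \<tau> (fib E x) UNIV \<and> \<tau> (bzero E x) = 0 \<and>
          (\<forall>e\<in>fib E x. \<forall>f\<in>fib E x. \<tau> (badd E e f) = \<tau> e + \<tau> f) \<and>
          (\<forall>a. \<forall>e\<in>fib E x. \<tau> (bscale E a e) = a *s \<tau> e))"
    using vbundle unfolding holomorphic_vbundle_def by (elim conjE)
  from bspec[OF this assms] show ?thesis
    by simp
qed

lemma open_triv: "(U, \<tau>) \<in> btriv E \<Longrightarrow> open U"
  using triv_all by blast

text \<open>The transition matrices are holomorphic and invertible, but only the smoothness of their entries is used.\<close>

lemma transition:
  assumes "(U, \<tau>) \<in> btriv E" "(V, \<sigma>) \<in> btriv E"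
  obtains G :: "'m \<Rightarrow> complex^'r^'r" where
    "\<And>x e. x \<in> U \<Longrightarrow> x \<in> V \<Longrightarrow> e \<in> fib E x \<Longrightarrow> \<sigma> e = G x *v \<tau> e"
    "\<And>i j. smooth_map A (U \<inter> V) (\<lambda>x. G x $ i $ j)"
proof -
  have "\<forall>(U, \<tau>)\<in>btriv E. \<forall>(V, \<sigma>)\<in>btriv E. \<exists>G :: 'm \<Rightarrow> complex^'r^'r.
        (\<forall>x\<in>U \<inter> V. invertible (G x) \<and> (\<forall>e\<in>fib E x. \<sigma> e = G x *v \<tau> e)) \<and>
        (\<forall>i j. holomorphic_map A (U \<inter> V) (\<lambda>x. G x $ i $ j))"
    using vbundle unfolding holomorphic_vbundle_def by (elim conjE)
  from bspec[OF this assms(1), simplified, rule_format, OF assms(2)] show thesis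
    using that holomorphic_map_smooth by blast
qed

context
  fixes U \<tau> x
  assumes triv: "(U, \<tau>) \<in> btriv E" and x: "x \<in> U"
begin

lemma triv_bij: "bij_betw \<tau> (fib E x) UNIV"
  using triv_all[OF triv] x by blast

lemma triv_zero: "\<tau> (bzero E x) = 0"
  using triv_all[OF triv] x by blast

lemma triv_add: "e \<in> fib E x \<Longrightarrow> f \<in> fib E x \<Longrightarrow> \<tau> (badd E e f) = \<tau> e + \<tau> f"
  using triv_all[OF triv] x by blast

lemma triv_scale: "e \<in> fib E x \<Longrightarrow> \<tau> (bscale E a e) = a *s \<tau> e"
  using triv_all[OF triv] x by blast

lemma triv_eqD: "e \<in> fib E x \<Longrightarrow> f \<in> fib E x \<Longrightarrow> \<tau> e = \<tau> f \<Longrightarrow> e = f"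
  using triv_bij by (auto simp: bij_betw_def inj_on_def)

lemma triv_inv_fib: "triv_inv E \<tau> x w \<in> fib E x"
  unfolding triv_inv_def using triv_bij by (intro inv_into_into) (simp add: bij_betw_def)

lemma triv_triv_inv: "\<tau> (triv_inv E \<tau> x w) = w"
  unfolding triv_inv_def using triv_bij by (intro f_inv_into_f) (simp add: bij_betw_def)

lemma triv_inv_triv: "e \<in> fib E x \<Longrightarrow> triv_inv E \<tau> x (\<tau> e) = e"
  by (intro triv_eqD triv_inv_fib) (simp_all add: triv_triv_inv)

lemma triv_lincomb:
  assumes "\<And>i. i < k \<Longrightarrow> s i \<in> fib E x"
  shows "lincomb E x a s k \<in> fib E x" "\<tau> (lincomb E x a s k) = (\<Sum>i<k. a i *s \<tau> (s i))"
proof -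
  have "lincomb E x a s k \<in> fib E x \<and> \<tau> (lincomb E x a s k) = (\<Sum>i<k. a i *s \<tau> (s i))"
    using assms by (induction k) (auto simp: fib_closed triv_zero triv_add triv_scale)
  then show "lincomb E x a s k \<in> fib E x" "\<tau> (lincomb E x a s k) = (\<Sum>i<k. a i *s \<tau> (s i))"
    by blast+
qed

lemma lincomb_span:
  assumes "\<And>i. i < k \<Longrightarrow> s i \<in> fib E x"
  shows "{lincomb E x a s k | a. True} = {e \<in> fib E x. \<tau> e \<in> span_of k (\<lambda>i. \<tau> (s i))}"
proof (intro set_eqI iffI)
  fix e
  assume "e \<in> {lincomb E x a s k | a. True}"
  then show "e \<in> {e \<in> fib E x. \<tau> e \<in> span_of k (\<lambda>i. \<tau> (s i))}"
    using triv_lincomb[OF assms] span_of_sum[where f="\<lambda>i. \<tau> (s i)"] by auto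
next
  fix e
  assume e: "e \<in> {e \<in> fib E x. \<tau> e \<in> span_of k (\<lambda>i. \<tau> (s i))}"
  then obtain a where "\<tau> e = (\<Sum>i<k. a i *s \<tau> (s i))"
    unfolding span_of_def by blast
  then have "e = lincomb E x a s k"
    using e triv_lincomb[OF assms, where a=a] by (intro triv_eqD) auto
  then show "e \<in> {lincomb E x a s k | a. True}"
    by blast
qed

lemma lincomb_indep:
  assumes "\<And>i. i < k \<Longrightarrow> s i \<in> fib E x"
  shows "(\<forall>a. lincomb E x a s k = bzero E x \<longrightarrow> (\<forall>i<k. a i = 0)) \<longleftrightarrow>
    indep_family k (\<lambda>i. \<tau> (s i))"
proof -
  have "lincomb E x a s k = bzero E x \<longleftrightarrow> (\<Sum>i<k. a i *s \<tau> (s i)) = 0" for a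
    using triv_lincomb[of k s a, OF assms] triv_eqD[of "lincomb E x a s k" "bzero E x"] triv_zero fib_closed(1) by auto
  then show ?thesis
    by (simp add: indep_family_def)
qed

end

text \<open>The frame condition in terms of coordinate vectors with respect to a trivialization.\<close>

lemma frame_over_iff:
  assumes "(U, \<tau>) \<in> btriv E" "V \<subseteq> U" "\<And>i y. i < k \<Longrightarrow> y \<in> V \<Longrightarrow> s i y \<in> fib E y"
  shows "frame_over E F k V s \<longleftrightarrow> (\<forall>y\<in>V.
    F \<inter> fib E y = {e \<in> fib E y. \<tau> e \<in> span_of k (\<lambda>i. \<tau> (s i y))} \<and>
    indep_family k (\<lambda>i. \<tau> (s i y)))"
  unfolding frame_over_def
proof (rule ball_cong[OF refl])
  fix y
  assume y: "y \<in> V"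
  then have yU: "y \<in> U"
    using assms(2) by blast
  show "(F \<inter> fib E y = {lincomb E y a (\<lambda>i. s i y) k | a. True} \<and>
      (\<forall>a. lincomb E y a (\<lambda>i. s i y) k = bzero E y \<longrightarrow> (\<forall>i<k. a i = 0))) \<longleftrightarrow>
    (F \<inter> fib E y = {e \<in> fib E y. \<tau> e \<in> span_of k (\<lambda>i. \<tau> (s i y))} \<and>
    indep_family k (\<lambda>i. \<tau> (s i y)))"
    using lincomb_span[OF assms(1) yU, of k "\<lambda>i. s i y"]
      lincomb_indep[OF assms(1) yU, of k "\<lambda>i. s i y"] assms(3) y by simp
qed

lemma smooth_section_triv_inv:
  assumes triv: "(U, \<tau>) \<in> btriv E" and V: "open V" "V \<subseteq> U"
    and b: "\<And>j. smooth_map A V (\<lambda>y. b y $ j)"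
  shows "smooth_section A E V (\<lambda>y. triv_inv E \<tau> y (b y))"
  unfolding smooth_section_def
proof (intro conjI ballI, safe)
  fix y
  assume "y \<in> V"
  then show "triv_inv E \<tau> y (b y) \<in> fib E y"
    using triv_inv_fib[OF triv] V(2) by blast
next
  fix W \<sigma>
  assume W: "(W, \<sigma>) \<in> btriv E"
  obtain G :: "'m \<Rightarrow> complex^'r^'r" where
    G: "\<And>x e. x \<in> U \<Longrightarrow> x \<in> W \<Longrightarrow> e \<in> fib E x \<Longrightarrow> \<sigma> e = G x *v \<tau> e"
    and sG: "\<And>i j. smooth_map A (U \<inter> W) (\<lambda>x. G x $ i $ j)"
    using transition[OF triv W] by blast
  have VW: "open (V \<inter> W)" "V \<inter> W \<subseteq> U \<inter> W" "V \<inter> W \<subseteq> V"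
    using V open_triv[OF W] by auto
  have "smooth_map A (V \<inter> W) (\<lambda>y. \<Sum>j\<in>UNIV. G y $ i $ j * b y $ j)" for i
    by (rule smooth_map_sum[OF VW(1)], rule smooth_map_mult[OF VW(1)])
      (rule smooth_map_subset[OF sG VW(2)], rule smooth_map_subset[OF b VW(3)])
  then have "smooth_map A (V \<inter> W) (\<lambda>y. \<sigma> (triv_inv E \<tau> y (b y)) $ i)" for i
  proof (rule smooth_map_cong[OF VW(1), rotated])
    fix y
    assume "y \<in> V \<inter> W"
    then have "y \<in> U" "y \<in> W"
      using VW(2) by auto
    then show "(\<Sum>j\<in>UNIV. G y $ i $ j * b y $ j) = \<sigma> (triv_inv E \<tau> y (b y)) $ i"
      by (simp add: G triv_inv_fib[OF triv] triv_triv_inv[OF triv] matrix_vector_mult_def)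
  qed
  then show "smooth_map A (V \<inter> W) (\<lambda>y. \<sigma> (triv_inv E \<tau> y (b y)))"
    by (simp add: smooth_map_vec_iff[OF VW(1)])
qed

lemma smooth_section_coord:
  assumes "smooth_section A E W s" "(U, \<tau>) \<in> btriv E" "open V" "V \<subseteq> U" "V \<subseteq> W"
  shows "smooth_map A V (\<lambda>y. \<tau> (s y) $ j)"
proof -
  have "smooth_map A (W \<inter> U) (\<lambda>y. \<tau> (s y))"
    using assms(1,2) unfolding smooth_section_def by blast
  then have "smooth_map A V (\<lambda>y. \<tau> (s y))"
    by (rule smooth_map_subset) (use assms in blast)
  then show ?thesis
    by (simp add: smooth_map_vec_iff[OF assms(3)])
qed

lemma cutoff_section:
  assumes s: "smooth_section A E W s" and W: "open W" and \<beta>: "smooth_map A UNIV \<beta>"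
    and K: "closed K" "K \<subseteq> W" "\<And>y. y \<notin> K \<Longrightarrow> \<beta> y = (0::real)"
  shows "(\<lambda>y. if y \<in> W then bscale E (complex_of_real (\<beta> y)) (s y) else bzero E y) \<in> A0 A E"
    (is "?t \<in> _")
  unfolding A0_def smooth_section_def
proof (intro CollectI conjI ballI, safe)
  have sf: "s y \<in> fib E y" if "y \<in> W" for y
    using s that unfolding smooth_section_def by blast
  show "?t y \<in> fib E y" for y
    using sf fib_closed by auto
  fix V \<tau>
  assume V: "(V, \<tau>) \<in> btriv E"
  have "smooth_map A V (\<lambda>y. \<tau> (?t y))"
  proof (rule smooth_map_local)
    fix y
    assume y: "y \<in> V"
    show "\<exists>N. open N \<and> y \<in> N \<and> smooth_map A N (\<lambda>y. \<tau> (?t y))"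
    proof (cases "y \<in> W")
      case True
      have N: "open (V \<inter> W)"
        using open_triv[OF V] W by blast
      have \<beta>N: "smooth_map A (V \<inter> W) (\<lambda>y. complex_of_real (\<beta> y))"
        by (rule smooth_map_linear[OF N bounded_linear_of_real smooth_map_subset[OF \<beta>]]) simp
      have "smooth_map A (V \<inter> W) (\<lambda>y. \<tau> (?t y) $ j)" for j
      proof (rule smooth_map_cong[OF N])
        show "smooth_map A (V \<inter> W) (\<lambda>y. complex_of_real (\<beta> y) * \<tau> (s y) $ j)"
          by (rule smooth_map_mult[OF N \<beta>N smooth_section_coord[OF s V N]]) auto
        show "complex_of_real (\<beta> y) * \<tau> (s y) $ j = \<tau> (?t y) $ j" if "y \<in> V \<inter> W" for y
          using that triv_scale[OF V _ sf, of y] by simp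
      qed
      then have "smooth_map A (V \<inter> W) (\<lambda>y. \<tau> (?t y))"
        by (simp add: smooth_map_vec_iff[OF N])
      then show ?thesis
        using N True y by (intro exI[of _ "V \<inter> W"]) simp
    next
      case False
      have N: "open (V \<inter> - K)"
        using open_triv[OF V] K(1) by blast
      have "smooth_map A (V \<inter> - K) (\<lambda>y. \<tau> (?t y))"
        by (rule smooth_map_cong[OF N _ smooth_map_const[of _ 0]])
          (auto simp: K(3) triv_scale[OF V] sf triv_zero[OF V])
      then show ?thesis
        using N False y K(2) by (intro exI[of _ "V \<inter> - K"]) auto
    qed
  qed
  then show "smooth_map A (UNIV \<inter> V) (\<lambda>y. \<tau> (?t y))"
    by simp
qed

lemma bscale_1: "e \<in> fib E x \<Longrightarrow> bscale E 1 e = e"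
proof -
  assume e: "e \<in> fib E x"
  obtain U \<tau> where U: "(U, \<tau>) \<in> btriv E" "x \<in> U"
    by (rule ex_triv)
  show ?thesis
    using e by (intro triv_eqD[OF U] fib_closed) (simp_all add: triv_scale[OF U])
qed

text \<open>Every local section of \<open>F\<close> agrees near a given point with a global one.\<close>

lemma extend_section:
  assumes F: "fibrewise_subspace E F" and s: "smooth_section A E W s" "open W" "x \<in> W"
    and sF: "\<And>y. y \<in> W \<Longrightarrow> s y \<in> F"
  obtains t N where "t \<in> A0_sub A E F" "open N" "x \<in> N" "N \<subseteq> W" "\<And>y. y \<in> N \<Longrightarrow> t y = s y"
proof -
  obtain \<beta> :: "'m \<Rightarrow> real" and K N where b: "smooth_map A UNIV \<beta>" "closed K" "K \<subseteq> W"
    "\<And>y. y \<notin> K \<Longrightarrow> \<beta> y = 0" "open N" "x \<in> N" "N \<subseteq> W" "\<And>y. y \<in> N \<Longrightarrow> \<beta> y = 1"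
    using ex_bump[OF s(2,3)] by blast
  define t where "t y = (if y \<in> W then bscale E (complex_of_real (\<beta> y)) (s y) else bzero E y)" for y
  have sf: "s y \<in> fib E y" if "y \<in> W" for y
    using s(1) that unfolding smooth_section_def by blast
  have "t \<in> A0 A E"
    unfolding t_def[abs_def] by (rule cutoff_section[OF s(1,2) b(1-4)])
  moreover have "t y \<in> F" for y
  proof (cases "y \<in> W")
    case True
    then show ?thesis
      using fibrewise_subspaceD(3)[OF F sF sf] by (simp add: t_def)
  qed (simp add: t_def fibrewise_subspaceD(1)[OF F])
  moreover have "t y = s y" if "y \<in> N" for y
  proof -
    have "y \<in> W"
      using that b(7) by blast
    then show ?thesis
      using b(8)[OF that] bscale_1[OF sf] by (simp add: t_def)
  qed
  ultimately show thesis
    using that[of t N] b by (simp add: A0_sub_def)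
qed

end


text \<open>Near every point, \<open>F\<close> is spanned by \<open>k\<close> smooth sections whose coordinate vectors in some trivialization
  are in reduced form, with pivots that are constant on the neighbourhood.\<close>

definition normal_frames ::
  "('m::topological_space, 'n::finite) chart set \<Rightarrow> ('e, 'm, 'r::finite) vbundle \<Rightarrow> 'e set
    \<Rightarrow> nat \<Rightarrow> bool" where
  "normal_frames A E F k \<longleftrightarrow> (\<forall>x. \<exists>U \<tau> V p s. (U, \<tau>) \<in> btriv E \<and> open V \<and> x \<in> V \<and> V \<subseteq> U \<and>
    (\<forall>i<k. smooth_section A E V (s i)) \<and>
    (\<forall>y\<in>V. F \<inter> fib E y = {e \<in> fib E y. \<tau> e \<in> span_of k (\<lambda>i. \<tau> (s i y))} \<and>
           normalized k p (\<lambda>i. \<tau> (s i y))))"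

lemma normal_framesE:
  assumes "normal_frames A E F k"
  obtains U \<tau> V s p where "(U, \<tau>) \<in> btriv E" "open V" "x \<in> V" "V \<subseteq> U"
    "\<And>i. i < k \<Longrightarrow> smooth_section A E V (s i)"
    "\<And>y. y \<in> V \<Longrightarrow> F \<inter> fib E y = {e \<in> fib E y. \<tau> e \<in> span_of k (\<lambda>i. \<tau> (s i y))}"
    "\<And>y. y \<in> V \<Longrightarrow> normalized k p (\<lambda>i. \<tau> (s i y))"
proof -
  note * = assms[unfolded normal_frames_def, rule_format, of x]
  then show thesis
    by (elim exE conjE) (rule that, blast+)
qed

lemma smooth_section_fib: "smooth_section A E U s \<Longrightarrow> y \<in> U \<Longrightarrow> s y \<in> fib E y"
  by (simp add: smooth_section_def)

context hol_bundle
begin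

lemma normal_frames_subspace:
  assumes "normal_frames A E F k"
  shows "fibrewise_subspace E F"
proof -
  have "bzero E x \<in> F \<and> (\<forall>e\<in>F \<inter> fib E x. \<forall>f\<in>F \<inter> fib E x. badd E e f \<in> F) \<and>
    (\<forall>a. \<forall>e\<in>F \<inter> fib E x. bscale E a e \<in> F)" for x
  proof -
    obtain U \<tau> V p s where "(U, \<tau>) \<in> btriv E" "open V" "x \<in> V" "V \<subseteq> U"
      and "\<And>i. i < k \<Longrightarrow> smooth_section A E V (s i)"
      and F': "\<And>y. y \<in> V \<Longrightarrow> F \<inter> fib E y = {e \<in> fib E y. \<tau> e \<in> span_of k (\<lambda>i. \<tau> (s i y))}"
      and "\<And>y. y \<in> V \<Longrightarrow> normalized k p (\<lambda>i. \<tau> (s i y))"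
      by (rule normal_framesE[OF assms, of x]) (rule that, blast+)
    then have U: "(U, \<tau>) \<in> btriv E" "x \<in> U"
      by auto
    define S where "S = vec.span ((\<lambda>i. \<tau> (s i x)) ` {..<k})"
    have F: "e \<in> F \<longleftrightarrow> \<tau> e \<in> S" if "e \<in> fib E x" for e
      using F'[OF \<open>x \<in> V\<close>] that by (auto simp: S_def span_of_eq_span)
    have "bzero E x \<in> F"
      by (simp add: F fib_closed triv_zero[OF U] S_def vec.span_zero)
    moreover have "badd E e f \<in> F" if "e \<in> F \<inter> fib E x" "f \<in> F \<inter> fib E x" for e f
      using that by (auto simp: F fib_closed triv_add[OF U] S_def vec.span_add)
    moreover have "bscale E a e \<in> F" if "e \<in> F \<inter> fib E x" for a e
      using that by (auto simp: F fib_closed triv_scale[OF U] S_def vec.span_scale)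
    ultimately show ?thesis
      by blast
  qed
  then show ?thesis
    unfolding fibrewise_subspace_def by blast
qed

lemma smooth_subbundle_normal_frames:
  assumes "smooth_subbundle A E F"
  obtains k where "normal_frames A E F k"
proof -
  obtain k where k: "\<forall>x. \<exists>U s. open U \<and> x \<in> U \<and>
      (\<forall>i<k. smooth_section A E U (s i)) \<and> frame_over E F k U s"
    using assms unfolding smooth_subbundle_def by (elim exE)
  have "normal_frames A E F k"
    unfolding normal_frames_def
  proof
    fix x
    obtain W s where W: "open W" "x \<in> W" and s: "\<And>i. i < k \<Longrightarrow> smooth_section A E W (s i)"
      and fr: "frame_over E F k W s"
      using k[rule_format, of x] by (elim exE conjE) (rule that, blast+)
    obtain U \<tau> where U: "(U, \<tau>) \<in> btriv E" "x \<in> U"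
      by (rule ex_triv)
    have W': "open (W \<inter> U)" "x \<in> W \<inter> U" "W \<inter> U \<subseteq> U"
      using W U open_triv by auto
    have fr': "F \<inter> fib E y = {e \<in> fib E y. \<tau> e \<in> span_of k (\<lambda>i. \<tau> (s i y))} \<and>
        indep_family k (\<lambda>i. \<tau> (s i y))" if "y \<in> W \<inter> U" for y
    proof -
      have "\<forall>y\<in>W \<inter> U. F \<inter> fib E y = {e \<in> fib E y. \<tau> e \<in> span_of k (\<lambda>i. \<tau> (s i y))} \<and>
          indep_family k (\<lambda>i. \<tau> (s i y))"
      proof (rule iffD1[OF frame_over_iff[OF U(1) W'(3)]])
        show "frame_over E F k (W \<inter> U) s"
          using fr unfolding frame_over_def by blast
        show "s i y \<in> fib E y" if "i < k" "y \<in> W \<inter> U" for i y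
          using smooth_section_fib[OF s[OF that(1)]] that(2) by blast
      qed
      then show ?thesis
        using that by blast
    qed
    have "smooth_map A (W \<inter> U) (\<lambda>y. \<tau> (s i y) $ j)" if "i < k" for i j
      using smooth_section_coord[OF s[OF that] U(1) W'(1,3)] by blast
    then have sm': "\<forall>i<k. \<forall>j. smooth_map A (W \<inter> U) (\<lambda>y. \<tau> (s i y) $ j)"
      by blast
    have ind: "indep_family k (\<lambda>i. \<tau> (s i x))"
      using fr'[OF W'(2)] by blast
    obtain V p b where V: "open V" "x \<in> V" "V \<subseteq> W \<inter> U"
      and b: "\<And>i j. i < k \<Longrightarrow> smooth_map A V (\<lambda>y. b i y $ j)"
      and nb: "\<And>y. y \<in> V \<Longrightarrow> normalized k p (\<lambda>i. b i y)"
      and sb: "\<And>y. y \<in> V \<Longrightarrow> span_of k (\<lambda>i. b i y) = span_of k (\<lambda>i. \<tau> (s i y))"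
      by (rule smooth_row_reduction[OF W'(1,2) sm' ind]) (rule that, blast+)
    have VU: "V \<subseteq> U"
      using V by blast
    define t where "t i y = triv_inv E \<tau> y (b i y)" for i y
    have t: "\<tau> (t i y) = b i y" if "y \<in> V" for i y
      using triv_triv_inv[OF U(1)] that VU by (auto simp: t_def)
    have "smooth_section A E V (t i)" if "i < k" for i
      unfolding t_def[abs_def] by (rule smooth_section_triv_inv[OF U(1) V(1) VU b[OF that]])
    moreover have "F \<inter> fib E y = {e \<in> fib E y. \<tau> e \<in> span_of k (\<lambda>i. \<tau> (t i y))} \<and>
        normalized k p (\<lambda>i. \<tau> (t i y))" if "y \<in> V" for y
      using fr'[of y] V(3) sb[OF that] nb[OF that] t[OF that] that by auto
    ultimately show "\<exists>U \<tau> V p s. (U, \<tau>) \<in> btriv E \<and> open V \<and> x \<in> V \<and> V \<subseteq> U \<and>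
      (\<forall>i<k. smooth_section A E V (s i)) \<and>
      (\<forall>y\<in>V. F \<inter> fib E y = {e \<in> fib E y. \<tau> e \<in> span_of k (\<lambda>i. \<tau> (s i y))} \<and>
           normalized k p (\<lambda>i. \<tau> (s i y)))"
      using U(1) V VU
      by (intro exI[of _ U] exI[of _ \<tau>] exI[of _ V] exI[of _ p] exI[of _ t]) simp
  qed
  then show thesis
    by (rule that)
qed

text \<open>Every vector of \<open>F\<close> is the value of a global smooth section of \<open>F\<close>.\<close>

lemma section_through:
  assumes "normal_frames A E F k" "f \<in> F" "f \<in> fib E x"
  obtains t where "t \<in> A0_sub A E F" "t x = f"
proof -
  obtain U \<tau> V p s where U: "(U, \<tau>) \<in> btriv E" and V: "open V" "x \<in> V" "V \<subseteq> U"
    and s: "\<And>i. i < k \<Longrightarrow> smooth_section A E V (s i)"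
    and F: "\<And>y. y \<in> V \<Longrightarrow> F \<inter> fib E y = {e \<in> fib E y. \<tau> e \<in> span_of k (\<lambda>i. \<tau> (s i y))}"
    and "\<And>y. y \<in> V \<Longrightarrow> normalized k p (\<lambda>i. \<tau> (s i y))"
    by (rule normal_framesE[OF assms(1), of x]) (rule that, blast+)
  have "\<tau> f \<in> span_of k (\<lambda>i. \<tau> (s i x))"
    using F[OF V(2)] assms by blast
  then obtain a where a: "\<tau> f = (\<Sum>i<k. a i *s \<tau> (s i x))"
    unfolding span_of_def by blast
  define b where "b y = (\<Sum>i<k. a i *s \<tau> (s i y))" for y
  define u where "u y = triv_inv E \<tau> y (b y)" for y
  have "smooth_map A V (\<lambda>y. b y $ j)" for j
    unfolding b_def sum_component vector_smult_component
    by (rule smooth_map_sum[OF V(1)], rule smooth_map_mult[OF V(1) smooth_map_const],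
        rule smooth_section_coord[OF s U V(1,3)]) auto
  then have su: "smooth_section A E V u"
    unfolding u_def[abs_def] by (rule smooth_section_triv_inv[OF U V(1,3)])
  have uF: "u y \<in> F" if "y \<in> V" for y
  proof -
    have "y \<in> U"
      using that V(3) by blast
    then have "u y \<in> fib E y" "\<tau> (u y) = b y"
      unfolding u_def by (rule triv_inv_fib[OF U], rule triv_triv_inv[OF U])
    moreover have "b y \<in> span_of k (\<lambda>i. \<tau> (s i y))"
      unfolding b_def by (rule span_of_sum)
    ultimately have "u y \<in> F \<inter> fib E y"
      by (simp add: F[OF that])
    then show ?thesis
      by simp
  qed
  have ux: "u x = f"
    using triv_inv_triv[OF U _ assms(3)] V a by (auto simp: u_def b_def)
  obtain t N where "t \<in> A0_sub A E F" "x \<in> N" "\<And>y. y \<in> N \<Longrightarrow> t y = u y"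
    by (rule extend_section[OF normal_frames_subspace[OF assms(1)] su V(1,2) uF])
      (assumption, rule that, blast+)
  then show thesis
    using that[of t] ux by simp
qed

end


section \<open>Subbundles invariant under the Chern connection\<close>

locale chern_bundle = hol_bundle A E
  for A :: "('m::{t2_space,second_countable_topology}, 'n::finite) chart set"
    and E :: "('e, 'm, 'r::finite) vbundle" +
  fixes h :: "'e \<Rightarrow> 'e \<Rightarrow> complex" and D :: "('e, 'm, 'n) conn"
  assumes metric: "hermitian_metric A E h" and chern: "chern_connection A E h D"
begin

lemma connection_dbar:
  assumes "s \<in> A0 A E" "c \<in> A" "(U, \<tau>) \<in> btriv E" "x \<in> fst c" "x \<in> U"
  shows "\<tau> (part01 E (D s) c x v) $ i = mdbar (\<lambda>y. \<tau> (s y) $ i) c x v"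
proof -
  have "\<forall>s\<in>A0 A E. \<forall>c\<in>A. \<forall>(U, \<tau>)\<in>btriv E. \<forall>x\<in>fst c \<inter> U. \<forall>v i.
        \<tau> (part01 E (D s) c x v) $ i = mdbar (\<lambda>y. \<tau> (s y) $ i) c x v"
    using chern unfolding chern_connection_def by (elim conjE)
  from bspec[OF bspec[OF bspec[OF this assms(1)] assms(2)] assms(3)] show ?thesis
    using assms(4,5) by simp
qed

lemma connection_metric:
  assumes "s \<in> A0 A E" "t \<in> A0 A E" "c \<in> A" "x \<in> fst c"
  shows "mdiff (\<lambda>y. h (s y) (t y)) c x v = h (D s c x v) (t x) + h (s x) (D t c x v)"
  using chern assms by (simp add: chern_connection_def)

lemma connection_A1: "s \<in> A0 A E \<Longrightarrow> D s \<in> A1 A E"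
  using chern by (simp add: chern_connection_def connection_def)

lemma A1_fib:
  assumes "\<alpha> \<in> A1 A E" "c \<in> A" "x \<in> fst c"
  shows "\<alpha> c x v \<in> fib E x"
proof -
  have "\<forall>c\<in>A. \<forall>x\<in>fst c. (\<forall>v. \<alpha> c x v \<in> fib E x) \<and>
      (\<forall>v w. \<alpha> c x (v + w) = badd E (\<alpha> c x v) (\<alpha> c x w)) \<and>
      (\<forall>a v. \<alpha> c x (a *\<^sub>R v) = bscale E (complex_of_real a) (\<alpha> c x v))"
    using assms(1) unfolding A1_def mem_Collect_eq by (elim conjE)
  from bspec[OF bspec[OF this assms(2)] assms(3)] show ?thesis
    by (elim conjE) (rule spec)
qed

lemma connection_invariantD:
  assumes "connection_invariant A E D F" "t \<in> A0_sub A E F" "c \<in> A" "x \<in> fst c"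
  shows "D t c x v \<in> F" "D t c x v \<in> fib E x"
proof -
  have "D t \<in> A1_sub A E F"
    using assms unfolding connection_invariant_def by blast
  then show "D t c x v \<in> F" "D t c x v \<in> fib E x"
    using assms A1_fib by (auto simp: A1_sub_def)
qed

text \<open>The crucial step: the Dolbeault derivative of \<open>s i\<close> is a combination of the frame whose coefficients,
  read off at the pivots, are derivatives of constant functions.\<close>

lemma normalized_section_holomorphic:
  assumes U: "(U, \<tau>) \<in> btriv E" and V: "open V" "V \<subseteq> U"
    and F: "fibrewise_subspace E F" and inv: "connection_invariant A E D F"
    and s: "\<And>i. i < k \<Longrightarrow> smooth_section A E V (s i)"
    and FV: "\<And>y. y \<in> V \<Longrightarrow> F \<inter> fib E y = {e \<in> fib E y. \<tau> e \<in> span_of k (\<lambda>i. \<tau> (s i y))}"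
    and norm: "\<And>y. y \<in> V \<Longrightarrow> normalized k p (\<lambda>i. \<tau> (s i y))"
    and i: "i < k"
  shows "holomorphic_section A E V (s i)"
proof -
  have sf: "s l y \<in> fib E y" if "l < k" "y \<in> V" for l y
    using smooth_section_fib[OF s] that by blast
  have sF: "s i y \<in> F" if "y \<in> V" for y
  proof -
    have "\<tau> (s i y) \<in> span_of k (\<lambda>i. \<tau> (s i y))"
      unfolding span_of_eq_span by (rule vec.span_base) (use i in auto)
    then show ?thesis
      using FV[OF that] sf[OF i that] by blast
  qed
  have dbar: "mdbar (\<lambda>y. \<sigma> (s i y) $ j) c x v = 0"
    if c: "c \<in> A" "x \<in> fst c" and x: "x \<in> V" and W: "(W, \<sigma>) \<in> btriv E" "x \<in> W" for c x v W \<sigma> j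
  proof -
    obtain t N where t: "t \<in> A0_sub A E F" and N: "open N" "x \<in> N" "N \<subseteq> V"
      and eq: "\<And>y. y \<in> N \<Longrightarrow> t y = s i y"
      by (rule extend_section[OF F s[OF i] V(1) x sF]) (assumption, rule that, blast+)
    have tA0: "t \<in> A0 A E"
      using t by (simp add: A0_sub_def)
    have xU: "x \<in> U"
      using x V(2) by blast
    define w where "w = part01 E (D t) c x v"
    note Dt = connection_invariantD[OF inv t c]
    have w: "w \<in> F" "w \<in> fib E x"
      unfolding w_def part01_def
      by (intro fibrewise_subspaceD[OF F, where x=x] fib_closed Dt)+
    \<comment> \<open>The pivot coordinates of \<open>w\<close> are Dolbeault derivatives of \<open>0\<close> or \<open>1\<close>.\<close>
    have "\<tau> w = 0"
    proof (rule normalized_span_coord[OF norm[OF x]])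
      show "\<tau> w \<in> span_of k (\<lambda>i. \<tau> (s i x))"
        using FV[OF x] w by blast
      fix l
      assume l: "l < k"
      have "\<tau> w $ p l = mdbar (\<lambda>y. \<tau> (t y) $ p l) c x v"
        unfolding w_def by (rule connection_dbar[OF tA0 c(1) U c(2) xU])
      also have "\<dots> = mdbar (\<lambda>y. if i = l then 1 else 0) c x v"
      proof (rule mdbar_cong[OF c N(1,2)])
        fix y
        assume y: "y \<in> N"
        then have "y \<in> V"
          using N(3) by blast
        then show "\<tau> (t y) $ p l = (if i = l then 1 else 0)"
          using norm[of y] i l eq[OF y] by (simp add: normalized_def)
      qed
      also have "\<dots> = 0"
        by (simp add: mdbar_def mdiff_const)
      finally show "\<tau> w $ p l = 0" .
    qed
    then have "w = bzero E x"
      by (intro triv_eqD[OF U xU]) (simp_all add: w fib_closed triv_zero[OF U xU])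
    then have "\<sigma> w $ j = 0"
      by (simp add: triv_zero[OF W])
    moreover have "\<sigma> w $ j = mdbar (\<lambda>y. \<sigma> (t y) $ j) c x v"
      unfolding w_def by (rule connection_dbar[OF tA0 c(1) W(1) c(2) W(2)])
    moreover have "mdbar (\<lambda>y. \<sigma> (t y) $ j) c x v = mdbar (\<lambda>y. \<sigma> (s i y) $ j) c x v"
      by (rule mdbar_cong[OF c N(1,2)]) (simp add: eq)
    ultimately show ?thesis
      by simp
  qed
  show ?thesis
    unfolding holomorphic_section_def
  proof (intro conjI ballI, safe)
    show "s i y \<in> fib E y" if "y \<in> V" for y
      using sf[OF i that] .
    fix W \<sigma> j
    assume W: "(W, \<sigma>) \<in> btriv E"
    show "holomorphic_map A (V \<inter> W) (\<lambda>y. \<sigma> (s i y) $ j)"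
    proof (rule holomorphic_mapI)
      show "smooth_map A (V \<inter> W) (\<lambda>y. \<sigma> (s i y) $ j)"
        by (rule smooth_section_coord[OF s[OF i] W]) (use V open_triv[OF W] in auto)
      show "mdbar (\<lambda>y. \<sigma> (s i y) $ j) c x v = 0"
        if "c \<in> A" "x \<in> V \<inter> W" "x \<in> fst c" for c x v
        using that dbar[OF that(1,3) _ W] by blast
    qed
  qed
qed

lemma invariant_subbundle_holomorphic:
  assumes nf: "normal_frames A E F k" and inv: "connection_invariant A E D F"
  shows "holomorphic_subbundle A E F"
  unfolding holomorphic_subbundle_def
proof (intro exI[of _ k] allI)
  fix x
  obtain U \<tau> V p s where U: "(U, \<tau>) \<in> btriv E" and V: "open V" "x \<in> V" "V \<subseteq> U"
    and s: "\<And>i. i < k \<Longrightarrow> smooth_section A E V (s i)"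
    and F: "\<And>y. y \<in> V \<Longrightarrow> F \<inter> fib E y = {e \<in> fib E y. \<tau> e \<in> span_of k (\<lambda>i. \<tau> (s i y))}"
    and norm: "\<And>y. y \<in> V \<Longrightarrow> normalized k p (\<lambda>i. \<tau> (s i y))"
    by (rule normal_framesE[OF nf, of x]) (rule that, blast+)
  have "holomorphic_section A E V (s i)" if "i < k" for i
    by (rule normalized_section_holomorphic[OF U V(1,3) normal_frames_subspace[OF nf] inv s F norm that])
  moreover have "frame_over E F k V s"
  proof (rule iffD2[OF frame_over_iff[OF U V(3)]])
    show "s i y \<in> fib E y" if "i < k" "y \<in> V" for i y
      using smooth_section_fib[OF s[OF that(1)] that(2)] .
    show "\<forall>y\<in>V. F \<inter> fib E y = {e \<in> fib E y. \<tau> e \<in> span_of k (\<lambda>i. \<tau> (s i y))} \<and>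
        indep_family k (\<lambda>i. \<tau> (s i y))"
      using F normalized_indep[OF norm] by simp
  qed
  ultimately show "\<exists>U s. open U \<and> x \<in> U \<and> (\<forall>i<k. holomorphic_section A E U (s i)) \<and> frame_over E F k U s"
    using V by blast
qed

end


section \<open>Orthogonal complements\<close>

text \<open>Orthogonal projection onto the span of a finite set for a definite hermitian form on coordinate space.
  The elements of \<open>G\<close> may be dependent.\<close>

lemma orthogonal_projection:
  fixes H :: "complex^'r::finite \<Rightarrow> complex^'r \<Rightarrow> complex"
  assumes add: "\<And>u v w. H (u + v) w = H u w + H v w"
    and scale: "\<And>a v w. H (a *s v) w = a * H v w"
    and sym: "\<And>v w. H w v = cnj (H v w)"
    and pos: "\<And>v. v \<noteq> 0 \<Longrightarrow> H v v \<noteq> 0"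
    and "finite G"
  shows "\<exists>u\<in>vec.span G. \<forall>g\<in>G. H (v - u) g = 0"
  using \<open>finite G\<close>
proof (induction G arbitrary: v rule: finite_induct)
  case empty
  then show ?case
    by (auto simp: vec.span_zero)
next
  case (insert g G)
  have diff: "H (u - w) z = H u z - H w z" for u w z
    using add[of u "(-1) *s w" z] scale[of "-1" w z] by simp
  have span: "H w u = 0" if "\<And>f. f \<in> G \<Longrightarrow> H w f = 0" "u \<in> vec.span G" for w u
  proof -
    have "vec.subspace {u. H u w = 0}"
      using scale[of 0 0 w] by (intro vec.subspaceI) (auto simp: add scale)
    moreover have "G \<subseteq> {u. H u w = 0}"
      using that(1) sym[of _ w] by auto
    ultimately have "vec.span G \<subseteq> {u. H u w = 0}"
      using vec.span_minimal by blast
    then have "H u w = 0"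
      using that(2) by blast
    then show ?thesis
      using sym[of w u] by simp
  qed
  obtain u0 where u0: "u0 \<in> vec.span G" "\<And>f. f \<in> G \<Longrightarrow> H (g - u0) f = 0"
    using insert.IH[of g] by blast
  obtain u1 where u1: "u1 \<in> vec.span G" "\<And>f. f \<in> G \<Longrightarrow> H (v - u1) f = 0"
    using insert.IH[of v] by blast
  \<comment> \<open>\<open>n\<close> is the part of \<open>g\<close> orthogonal to \<open>G\<close>; it vanishes if \<open>g\<close> is already in the span, and then \<open>t = 0\<close>.\<close>
  define n w where "n = g - u0" and "w = v - u1"
  define t where "t = H w n / H n n"
  define u where "u = u1 + t *s n"
  have mono: "vec.span G \<subseteq> vec.span (insert g G)"
    by (rule vec.span_mono) auto
  have "u \<in> vec.span (insert g G)"
    unfolding u_def n_def using u0(1) u1(1) mono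
    by (intro vec.span_add vec.span_scale vec.span_diff) (auto intro: vec.span_base)
  moreover have vu: "v - u = w - t *s n"
    by (simp add: u_def w_def)
  have G0: "H (v - u) f = 0" if "f \<in> G" for f
    using that u0(2) u1(2) by (simp add: vu diff scale n_def w_def)
  moreover have "H (v - u) g = 0"
  proof -
    have "H (v - u) u0 = 0"
      using span[OF G0 u0(1)] .
    moreover have "H (v - u) n = 0"
    proof (cases "n = 0")
      case True
      have "H n (v - u) = 0"
        using True scale[of 0 0 "v - u"] by simp
      then show ?thesis
        using sym[of "v - u" n] by simp
    next
      case False
      then show ?thesis
        using pos[OF False] by (simp add: vu diff scale t_def)
    qed
    moreover have "H (v - u) g = H (v - u) n + H (v - u) u0"
      using add[of n u0 "v - u"] sym[of "v - u"] by (simp add: n_def)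
    ultimately show ?thesis
      by simp
  qed
  ultimately show ?case
    by blast
qed

lemma pairing_linear:
  "pairing (u + v) w = pairing u w + pairing v w"
  "pairing (a *s v) w = a * pairing v w"
  "pairing v (u + w) = pairing v u + pairing v w"
  "pairing v (a *s w) = a * pairing v w"
  "pairing 0 w = 0" "pairing v 0 = 0"
  by (simp_all add: pairing_def algebra_simps sum.distrib sum_distrib_left)

lemma pairing_sum:
  "pairing (\<Sum>i\<in>I. v i) w = (\<Sum>i\<in>I. pairing (v i) w)"
  "pairing u (\<Sum>i\<in>I. v i) = (\<Sum>i\<in>I. pairing u (v i))"
  by (induction I rule: infinite_finite_induct) (simp_all add: pairing_linear)

context chern_bundle
begin

lemma h_add:
  assumes "e \<in> fib E x" "e' \<in> fib E x" "f \<in> fib E x"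
  shows "h (badd E e e') f = h e f + h e' f"
  using metric assms unfolding hermitian_metric_def by blast

lemma h_scale:
  assumes "e \<in> fib E x" "f \<in> fib E x"
  shows "h (bscale E a e) f = a * h e f"
  using metric assms unfolding hermitian_metric_def by blast

lemma h_sym:
  assumes "e \<in> fib E x" "f \<in> fib E x"
  shows "h f e = cnj (h e f)"
  using metric assms unfolding hermitian_metric_def by blast

lemma h_definite:
  assumes "e \<in> fib E x" "h e e = 0"
  shows "e = bzero E x"
proof (rule ccontr)
  assume "e \<noteq> bzero E x"
  then have "0 < Re (h e e)"
    using metric assms(1) unfolding hermitian_metric_def by blast
  then show False
    using assms(2) by simp
qed

text \<open>The row that represents the linear form \<open>h(-, f)\<close> on the fibre over \<open>x\<close> in the coordinates given by \<open>\<tau>\<close>.\<close>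

definition metric_row :: "('e \<Rightarrow> complex^'r) \<Rightarrow> 'm \<Rightarrow> 'e \<Rightarrow> complex^'r" where
  "metric_row \<tau> x f = (\<chi> j. h (triv_inv E \<tau> x (axis j 1)) f)"

lemma h_eq_pairing:
  assumes U: "(U, \<tau>) \<in> btriv E" "x \<in> U" and ef: "e \<in> fib E x" "f \<in> fib E x"
  shows "h e f = pairing (\<tau> e) (metric_row \<tau> x f)"
proof -
  define L where "L v = h (triv_inv E \<tau> x v) f" for v
  have add: "L (v + w) = L v + L w" for v w
  proof -
    have "triv_inv E \<tau> x (v + w) = badd E (triv_inv E \<tau> x v) (triv_inv E \<tau> x w)"
      by (rule triv_eqD[OF U])
        (simp_all add: triv_inv_fib[OF U] fib_closed triv_triv_inv[OF U] triv_add[OF U])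
    then show ?thesis
      unfolding L_def by (simp add: h_add[OF triv_inv_fib[OF U] triv_inv_fib[OF U] ef(2)])
  qed
  have scale: "L (a *s v) = a * L v" for a v
  proof -
    have "triv_inv E \<tau> x (a *s v) = bscale E a (triv_inv E \<tau> x v)"
      by (rule triv_eqD[OF U])
        (simp_all add: triv_inv_fib[OF U] fib_closed triv_triv_inv[OF U] triv_scale[OF U])
    then show ?thesis
      unfolding L_def by (simp add: h_scale[OF triv_inv_fib[OF U] ef(2)])
  qed
  have zero: "L 0 = 0"
    using scale[of 0 0] by simp
  have sum: "L (\<Sum>j\<in>J. v j) = (\<Sum>j\<in>J. L (v j))" for J :: "'r set" and v
    by (induction J rule: infinite_finite_induct) (simp_all add: add zero)
  have "h e f = L (\<Sum>j\<in>UNIV. \<tau> e $ j *s axis j 1)"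
    by (simp add: L_def basis_expansion triv_inv_triv[OF U ef(1)])
  also have "\<dots> = (\<Sum>j\<in>UNIV. \<tau> e $ j * L (axis j 1))"
    by (simp only: sum scale)
  also have "\<dots> = pairing (\<tau> e) (metric_row \<tau> x f)"
    by (simp add: pairing_def metric_row_def L_def)
  finally show ?thesis .
qed

lemma metric_row_smooth:
  assumes U: "(U, \<tau>) \<in> btriv E" and V: "open V" "V \<subseteq> U" and s: "smooth_section A E V s"
  shows "smooth_map A V (\<lambda>y. metric_row \<tau> y (s y) $ j)"
proof -
  \<comment> \<open>The given smoothness concerns constant coordinate vectors; expand \<open>s\<close> in its coordinates.\<close>
  have gram: "smooth_map A V (\<lambda>y. h (triv_inv E \<tau> y (axis l 1)) (triv_inv E \<tau> y (axis j 1)))" for l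
  proof -
    have "\<forall>(U, \<tau>)\<in>btriv E. \<forall>w w'. smooth_map A U (\<lambda>x. h (triv_inv E \<tau> x w) (triv_inv E \<tau> x w'))"
      using metric unfolding hermitian_metric_def by (elim conjE)
    from bspec[OF this U] have "smooth_map A U (\<lambda>x. h (triv_inv E \<tau> x w) (triv_inv E \<tau> x w'))" for w w'
      by simp
    then show ?thesis
      by (rule smooth_map_subset) (rule V(2))
  qed
  have "smooth_map A V (\<lambda>y. \<tau> (s y) $ l)" for l
    using smooth_section_coord[OF s U V] by simp
  then have "smooth_map A V (\<lambda>y. \<Sum>l\<in>UNIV. \<tau> (s y) $ l *
      h (triv_inv E \<tau> y (axis l 1)) (triv_inv E \<tau> y (axis j 1)))"
    by (intro smooth_map_sum[OF V(1)] smooth_map_mult[OF V(1)] gram)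
  then have "smooth_map A V (\<lambda>y. cnj (\<Sum>l\<in>UNIV. \<tau> (s y) $ l *
      h (triv_inv E \<tau> y (axis l 1)) (triv_inv E \<tau> y (axis j 1))))"
    by (rule smooth_map_linear[OF V(1) bounded_linear_cnj])
  then show ?thesis
  proof (rule smooth_map_cong[OF V(1), rotated])
    fix y
    assume y: "y \<in> V"
    then have yU: "y \<in> U"
      using V(2) by blast
    note f = smooth_section_fib[OF s y] triv_inv_fib[OF U yU, of "axis j 1"]
    have "h (triv_inv E \<tau> y (axis j 1)) (s y) = cnj (h (s y) (triv_inv E \<tau> y (axis j 1)))"
      by (rule h_sym[OF f])
    then show "cnj (\<Sum>l\<in>UNIV. \<tau> (s y) $ l *
      h (triv_inv E \<tau> y (axis l 1)) (triv_inv E \<tau> y (axis j 1))) = metric_row \<tau> y (s y) $ j"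
      by (simp add: h_eq_pairing[OF U yU f] pairing_def metric_row_def)
  qed
qed

lemma orthogonal_complement_fib:
  assumes "e \<in> fib E x"
  shows "e \<in> orthogonal_complement E h F \<longleftrightarrow> (\<forall>f\<in>F \<inter> fib E x. h e f = 0)"
proof -
  have "bproj E e = x"
    using assms by (simp add: fib_def)
  then show ?thesis
    by (simp add: orthogonal_complement_def)
qed

text \<open>It suffices to test orthogonality on a spanning family.\<close>

lemma orthogonal_complement_kernel:
  assumes U: "(U, \<tau>) \<in> btriv E" "x \<in> U" and s: "\<And>i. i < k \<Longrightarrow> s i \<in> fib E x"
    and F: "F \<inter> fib E x = {e \<in> fib E x. \<tau> e \<in> span_of k (\<lambda>i. \<tau> (s i))}"
    and e: "e \<in> fib E x"
  shows "e \<in> orthogonal_complement E h F \<longleftrightarrow> (\<forall>i<k. pairing (\<tau> e) (metric_row \<tau> x (s i)) = 0)"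
proof -
  have "(\<forall>f\<in>F \<inter> fib E x. h e f = 0) \<longleftrightarrow> (\<forall>i<k. h e (s i) = 0)"
  proof (intro iffI allI impI ballI)
    fix i
    assume "\<forall>f\<in>F \<inter> fib E x. h e f = 0" and i: "i < k"
    moreover have "\<tau> (s i) \<in> span_of k (\<lambda>i. \<tau> (s i))"
      unfolding span_of_eq_span by (rule vec.span_base) (use i in auto)
    ultimately show "h e (s i) = 0"
      using F s[OF i] by simp
  next
    fix f
    assume 0: "\<forall>i<k. h e (s i) = 0" and f: "f \<in> F \<inter> fib E x"
    then obtain a where a: "\<tau> f = (\<Sum>i<k. a i *s \<tau> (s i))"
      unfolding F span_of_def by blast
    have "h f e = (\<Sum>i<k. a i * pairing (\<tau> (s i)) (metric_row \<tau> x e))"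
      using f by (simp add: h_eq_pairing[OF U _ e] a pairing_sum pairing_linear)
    also have "\<dots> = 0"
    proof (rule sum.neutral, rule ballI)
      fix i
      assume i: "i \<in> {..<k}"
      then have "s i \<in> fib E x"
        using s by simp
      then have "pairing (\<tau> (s i)) (metric_row \<tau> x e) = cnj (h e (s i))"
        using h_eq_pairing[OF U _ e] h_sym[OF e] by simp
      then show "a i * pairing (\<tau> (s i)) (metric_row \<tau> x e) = 0"
        using 0 i by simp
    qed
    finally show "h e f = 0"
      using h_sym[of f x e] f e by simp
  qed
  also have "\<dots> \<longleftrightarrow> (\<forall>i<k. pairing (\<tau> e) (metric_row \<tau> x (s i)) = 0)"
    using h_eq_pairing[OF U e s] by simp
  finally show ?thesis
    by (simp add: orthogonal_complement_fib[OF e])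
qed

text \<open>If \<open>\<Sum> a\<^sub>i h(-, s\<^sub>i) = 0\<close>, then the vector \<open>f\<close> that combines the \<open>s\<^sub>i\<close> with the conjugate coefficients has \<open>h(f, f) = 0\<close>.\<close>

lemma metric_row_indep:
  assumes U: "(U, \<tau>) \<in> btriv E" "x \<in> U" and s: "\<And>i. i < k \<Longrightarrow> s i \<in> fib E x"
    and ind: "indep_family k (\<lambda>i. \<tau> (s i))"
  shows "indep_family k (\<lambda>i. metric_row \<tau> x (s i))"
  unfolding indep_family_def
proof (intro allI impI)
  fix a i
  assume 0: "(\<Sum>i<k. a i *s metric_row \<tau> x (s i)) = 0" and i: "i < k"
  define f where "f = triv_inv E \<tau> x (\<Sum>i<k. cnj (a i) *s \<tau> (s i))"
  have f: "f \<in> fib E x" and \<tau>f: "\<tau> f = (\<Sum>i<k. cnj (a i) *s \<tau> (s i))"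
    unfolding f_def by (rule triv_inv_fib[OF U], rule triv_triv_inv[OF U])
  have "h f f = (\<Sum>i<k. cnj (a i) * pairing (\<tau> (s i)) (metric_row \<tau> x f))"
    by (simp add: h_eq_pairing[OF U f f] \<tau>f pairing_sum pairing_linear)
  also have "\<dots> = (\<Sum>i<k. cnj (a i * pairing (\<tau> f) (metric_row \<tau> x (s i))))"
  proof (rule sum.cong[OF refl])
    fix i
    assume "i \<in> {..<k}"
    then have si: "s i \<in> fib E x"
      using s by simp
    have "pairing (\<tau> (s i)) (metric_row \<tau> x f) = cnj (pairing (\<tau> f) (metric_row \<tau> x (s i)))"
      using h_sym[OF f si] by (simp add: h_eq_pairing[OF U f si] h_eq_pairing[OF U si f])
    then show "cnj (a i) * pairing (\<tau> (s i)) (metric_row \<tau> x f) =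
        cnj (a i * pairing (\<tau> f) (metric_row \<tau> x (s i)))"
      by simp
  qed
  also have "\<dots> = cnj (pairing (\<tau> f) (\<Sum>i<k. a i *s metric_row \<tau> x (s i)))"
    by (simp only: pairing_sum pairing_linear cnj_sum)
  also have "\<dots> = 0"
    by (simp add: 0 pairing_linear)
  finally have "f = bzero E x"
    by (rule h_definite[OF f])
  then have "(\<Sum>i<k. cnj (a i) *s \<tau> (s i)) = 0"
    using \<tau>f triv_zero[OF U] by simp
  then have "cnj (a i) = 0"
    using ind i unfolding indep_family_def by (elim allE[of _ "\<lambda>i. cnj (a i)"]) simp
  then show "a i = 0"
    by simp
qed

lemma orthogonal_complement_normal_frames:
  assumes nf: "normal_frames A E F k"
  shows "normal_frames A E (orthogonal_complement E h F) (CARD('r) - k)"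
  unfolding normal_frames_def
proof
  fix x
  define m where "m = CARD('r) - k"
  obtain U \<tau> V p s where U: "(U, \<tau>) \<in> btriv E" and V: "open V" "x \<in> V" "V \<subseteq> U"
    and s: "\<And>i. i < k \<Longrightarrow> smooth_section A E V (s i)"
    and F: "\<And>y. y \<in> V \<Longrightarrow> F \<inter> fib E y = {e \<in> fib E y. \<tau> e \<in> span_of k (\<lambda>i. \<tau> (s i y))}"
    and norm: "\<And>y. y \<in> V \<Longrightarrow> normalized k p (\<lambda>i. \<tau> (s i y))"
    by (rule normal_framesE[OF nf, of x]) (rule that, blast+)
  define r where "r i y = metric_row \<tau> y (s i y)" for i y
  have sf: "s i y \<in> fib E y" if "i < k" "y \<in> V" for i y
    using smooth_section_fib[OF s[OF that(1)] that(2)] .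
  have xU: "x \<in> U"
    using V by blast
  have sr: "\<forall>i<k. \<forall>j. smooth_map A V (\<lambda>y. r i y $ j)"
    unfolding r_def using metric_row_smooth[OF U V(1,3) s] by simp
  have "indep_family k (\<lambda>i. r i x)"
    unfolding r_def
    by (rule metric_row_indep[OF U xU sf normalized_indep[OF norm[OF V(2)]]]) (use V(2) in auto)
  then obtain W q' b where W: "open W" "x \<in> W" "W \<subseteq> V"
    and b: "\<And>i j. i < k \<Longrightarrow> smooth_map A W (\<lambda>y. b i y $ j)"
    and nb: "\<And>y. y \<in> W \<Longrightarrow> normalized k q' (\<lambda>i. b i y)"
    and sb: "\<And>y. y \<in> W \<Longrightarrow> span_of k (\<lambda>i. b i y) = span_of k (\<lambda>i. r i y)"
    by (rule smooth_row_reduction[OF V(1,2) sr]) (rule that, blast+)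
  have "card (- q' ` {..<k}) = m"
    using card_image[OF normalized_inj[OF nb[OF W(2)]]]
    by (simp add: m_def Compl_eq_Diff_UNIV card_Diff_subset)
  then obtain q where q: "bij_betw q {..<m} (- q' ` {..<k})"
    using ex_bij_betw_nat_finite[of "- q' ` {..<k}"] by (auto simp: atLeast0LessThan)
  define z where "z i y = kernel_basis k q' (\<lambda>l. b l y) (q i)" for i y
  define t where "t i y = triv_inv E \<tau> y (z i y)" for i y
  have WU: "W \<subseteq> U"
    using W V by blast
  have "smooth_map A W (\<lambda>y. z i y $ j)" for i j
    unfolding z_def kernel_basis_def vector_minus_component sum_component vector_smult_component
    by (intro smooth_map_diff[OF W(1)] smooth_map_const smooth_map_sum[OF W(1)]
        smooth_map_mult[OF W(1)]) (use b in simp)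
  then have st: "smooth_section A E W (t i)" for i
    unfolding t_def[abs_def] by (rule smooth_section_triv_inv[OF U W(1) WU])
  have \<tau>t: "\<tau> (t i y) = z i y" if "y \<in> W" for i y
    unfolding t_def using triv_triv_inv[OF U] that WU by blast
  have "orthogonal_complement E h F \<inter> fib E y
      = {e \<in> fib E y. \<tau> e \<in> span_of m (\<lambda>i. \<tau> (t i y))} \<and> normalized m q (\<lambda>i. \<tau> (t i y))"
    if y: "y \<in> W" for y
  proof
    have yV: "y \<in> V" and yU: "y \<in> U"
      using y W(3) WU by auto
    have "e \<in> orthogonal_complement E h F \<longleftrightarrow> \<tau> e \<in> span_of m (\<lambda>i. \<tau> (t i y))"
      if e: "e \<in> fib E y" for e
    proof -
      have "e \<in> orthogonal_complement E h F \<longleftrightarrow> (\<forall>i<k. pairing (\<tau> e) (r i y) = 0)"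
        unfolding r_def
        by (rule orthogonal_complement_kernel[OF U yU _ F[OF yV] e]) (rule sf[OF _ yV])
      also have "\<dots> \<longleftrightarrow> (\<forall>i<k. pairing (\<tau> e) (b i y) = 0)"
        by (rule pairing_span[OF sb[OF y], symmetric])
      also have "\<dots> \<longleftrightarrow> \<tau> e \<in> span_of m (\<lambda>i. z i y)"
        unfolding z_def kernel_eq_span(2)[OF nb[OF y] q, symmetric] by simp
      finally show ?thesis
        by (simp add: \<tau>t[OF y])
    qed
    then show "orthogonal_complement E h F \<inter> fib E y
      = {e \<in> fib E y. \<tau> e \<in> span_of m (\<lambda>i. \<tau> (t i y))}"
      by blast
    show "normalized m q (\<lambda>i. \<tau> (t i y))"
      using kernel_eq_span(1)[OF nb[OF y] q] by (simp add: \<tau>t[OF y] z_def)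
  qed
  then show "\<exists>U \<tau> V p s. (U, \<tau>) \<in> btriv E \<and> open V \<and> x \<in> V \<and> V \<subseteq> U \<and>
      (\<forall>i<CARD('r) - k. smooth_section A E V (s i)) \<and>
      (\<forall>y\<in>V. orthogonal_complement E h F \<inter> fib E y
          = {e \<in> fib E y. \<tau> e \<in> span_of (CARD('r) - k) (\<lambda>i. \<tau> (s i y))} \<and>
        normalized (CARD('r) - k) p (\<lambda>i. \<tau> (s i y)))"
    unfolding m_def[symmetric] using U W WU st
    by (intro exI[of _ U] exI[of _ \<tau>] exI[of _ W] exI[of _ q] exI[of _ t]) simp
qed

lemma orthogonal_complement_invariant:
  assumes nf: "normal_frames A E F k" and inv: "connection_invariant A E D F"
  shows "connection_invariant A E D (orthogonal_complement E h F)"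
  unfolding connection_invariant_def
proof
  fix s
  assume s: "s \<in> A0_sub A E (orthogonal_complement E h F)"
  then have sA0: "s \<in> A0 A E" and sF: "\<And>y. s y \<in> orthogonal_complement E h F"
    by (auto simp: A0_sub_def)
  have sfib: "s y \<in> fib E y" for y
    using sA0 by (simp add: A0_def smooth_section_def)
  have "D s c x v \<in> orthogonal_complement E h F" if c: "c \<in> A" "x \<in> fst c" for c x v
    unfolding orthogonal_complement_fib[OF A1_fib[OF connection_A1[OF sA0] c]]
  proof
    fix f
    assume f: "f \<in> F \<inter> fib E x"
    obtain t where t: "t \<in> A0_sub A E F" "t x = f"
      by (rule section_through[OF nf, of f x]) (use f in blast)+
    then have tA0: "t \<in> A0 A E" and tF: "\<And>y. t y \<in> F"
      by (auto simp: A0_sub_def)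
    have tfib: "t y \<in> fib E y" for y
      using tA0 by (simp add: A0_def smooth_section_def)
    have "h (s y) (t y) = 0" for y
      using sF[of y] tF tfib orthogonal_complement_fib[OF sfib] by blast
    then have "mdiff (\<lambda>y. h (s y) (t y)) c x v = 0"
      by (simp add: mdiff_const)
    moreover have "h (s x) (D t c x v) = 0"
      using sF[of x] connection_invariantD[OF inv t(1) c] orthogonal_complement_fib[OF sfib] by blast
    ultimately show "h (D s c x v) f = 0"
      using connection_metric[OF sA0 tA0 c, of v] t(2) by simp
  qed
  then show "D s \<in> A1_sub A E (orthogonal_complement E h F)"
    using connection_A1[OF sA0] by (simp add: A1_sub_def)
qed

lemma orthogonal_complement_zero:
  assumes "e \<in> F" "e \<in> orthogonal_complement E h F" "e \<in> fib E x"
  shows "e = bzero E x"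
  using assms h_definite orthogonal_complement_fib by blast

lemma orthogonal_decomposition:
  assumes nf: "normal_frames A E F k" and e: "e \<in> fib E x"
  shows "\<exists>!(f, g). f \<in> F \<inter> fib E x \<and> g \<in> orthogonal_complement E h F \<inter> fib E x \<and> e = badd E f g"
proof -
  obtain U \<tau> V p s where U: "(U, \<tau>) \<in> btriv E" and V: "open V" "x \<in> V" "V \<subseteq> U"
    and s: "\<And>i. i < k \<Longrightarrow> smooth_section A E V (s i)"
    and F: "\<And>y. y \<in> V \<Longrightarrow> F \<inter> fib E y = {e \<in> fib E y. \<tau> e \<in> span_of k (\<lambda>i. \<tau> (s i y))}"
    and norm: "\<And>y. y \<in> V \<Longrightarrow> normalized k p (\<lambda>i. \<tau> (s i y))"
    by (rule normal_framesE[OF nf, of x]) (rule that, blast+)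
  have U: "(U, \<tau>) \<in> btriv E" "x \<in> U"
    using U V by auto
  define G where "G = (\<lambda>i. \<tau> (s i x)) ` {..<k}"
  have F: "F \<inter> fib E x = {e \<in> fib E x. \<tau> e \<in> vec.span G}"
    using F[OF V(2)] by (simp add: G_def span_of_eq_span)
  define H where "H v w = h (triv_inv E \<tau> x v) (triv_inv E \<tau> x w)" for v w
  have H: "H v w = pairing v (metric_row \<tau> x (triv_inv E \<tau> x w))" for v w
    by (simp add: H_def h_eq_pairing[OF U triv_inv_fib[OF U] triv_inv_fib[OF U]] triv_triv_inv[OF U])
  have "\<exists>u\<in>vec.span G. \<forall>g\<in>G. H (\<tau> e - u) g = 0"
  proof (rule orthogonal_projection)
    show "H (u + v) w = H u w + H v w" "H (a *s v) w = a * H v w" for a u v w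
      by (simp_all add: H pairing_linear)
    show "H w v = cnj (H v w)" for v w
      unfolding H_def by (rule h_sym[OF triv_inv_fib[OF U] triv_inv_fib[OF U]])
    show "H v v \<noteq> 0" if "v \<noteq> 0" for v
    proof
      assume "H v v = 0"
      then have "triv_inv E \<tau> x v = bzero E x"
        unfolding H_def by (rule h_definite[OF triv_inv_fib[OF U]])
      then have "v = \<tau> (bzero E x)"
        using triv_triv_inv[OF U, of v] by simp
      then show False
        using that triv_zero[OF U] by simp
    qed
    show "finite G"
      by (simp add: G_def)
  qed
  then obtain u where u: "u \<in> vec.span G" "\<And>g. g \<in> G \<Longrightarrow> H (\<tau> e - u) g = 0"
    by blast
  define f g where "f = triv_inv E \<tau> x u" and "g = triv_inv E \<tau> x (\<tau> e - u)"
  have ff: "f \<in> fib E x" "\<tau> f = u" and gf: "g \<in> fib E x" "\<tau> g = \<tau> e - u"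
    by (simp_all add: f_def g_def triv_inv_fib[OF U] triv_triv_inv[OF U])
  have fF: "f \<in> F \<inter> fib E x"
    by (simp add: F ff u(1))
  have sf: "s i x \<in> fib E x" if "i < k" for i
    using smooth_section_fib[OF s[OF that] V(2)] .
  have "pairing (\<tau> g) (metric_row \<tau> x (s i x)) = 0" if "i < k" for i
  proof -
    have "H (\<tau> e - u) (\<tau> (s i x)) = 0"
      by (rule u(2)) (use that in \<open>simp add: G_def\<close>)
    then show ?thesis
      by (simp add: H gf triv_inv_triv[OF U sf[OF that]])
  qed
  then have gG: "g \<in> orthogonal_complement E h F \<inter> fib E x"
    using orthogonal_complement_kernel[OF U, of k "\<lambda>i. s i x" F g] sf gf(1) F
    by (simp add: G_def span_of_eq_span)
  have efg: "e = badd E f g"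
    by (rule triv_eqD[OF U e]) (simp_all add: fib_closed ff gf triv_add[OF U])
  note subF = normal_frames_subspace[OF nf]
    and subG = normal_frames_subspace[OF orthogonal_complement_normal_frames[OF nf]]
  have uniq: "f' = f \<and> g' = g"
    if f': "f' \<in> F" "f' \<in> fib E x" and g': "g' \<in> orthogonal_complement E h F" "g' \<in> fib E x"
      and e': "e = badd E f' g'" for f' g'
  proof -
    \<comment> \<open>The difference \<open>f' - f = g - g'\<close> lies in \<open>F\<close> and in its complement.\<close>
    define d where "d = badd E f' (bscale E (-1) f)"
    have d: "d \<in> fib E x" "\<tau> d = \<tau> f' - \<tau> f"
      using f'(2) ff(1) by (simp_all add: d_def fib_closed triv_add[OF U] triv_scale[OF U])
    have "d \<in> F"
      unfolding d_def using f' fF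
      by (intro fibrewise_subspaceD(2)[OF subF, where x=x] fibrewise_subspaceD(3)[OF subF, where x=x]
          fib_closed) auto
    moreover have sum: "\<tau> f' + \<tau> g' = \<tau> f + \<tau> g"
      using e' efg f' g' ff gf triv_add[OF U] by metis
    have "d = badd E g (bscale E (-1) g')"
      using sum g'(2) gf(1)
      by (intro triv_eqD[OF U d(1)])
        (simp_all add: d fib_closed triv_add[OF U] triv_scale[OF U] algebra_simps)
    then have "d \<in> orthogonal_complement E h F"
      using g' gG
      by (auto intro!: fibrewise_subspaceD(2)[OF subG, where x=x]
          fibrewise_subspaceD(3)[OF subG, where x=x] fib_closed)
    ultimately have "d = bzero E x"
      using orthogonal_complement_zero d(1) by blast
    then have "\<tau> f' = \<tau> f"
      using d(2) triv_zero[OF U] by simp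
    then show ?thesis
      using sum triv_eqD[OF U] f' g' ff(1) gf(1) by simp
  qed
  show ?thesis
  proof (rule ex1I[of _ "(f, g)"])
    show "case (f, g) of (f, g) \<Rightarrow>
      f \<in> F \<inter> fib E x \<and> g \<in> orthogonal_complement E h F \<inter> fib E x \<and> e = badd E f g"
      using fF gG efg by simp
  next
    fix fg
    assume *: "case fg of (f, g) \<Rightarrow>
      f \<in> F \<inter> fib E x \<and> g \<in> orthogonal_complement E h F \<inter> fib E x \<and> e = badd E f g"
    obtain f' g' where fg: "fg = (f', g')"
      by (cases fg)
    have "f' = f \<and> g' = g"
      by (rule uniq) (use *[unfolded fg] in auto)
    then show "fg = (f, g)"
      by (simp add: fg)
  qed
qed

lemma orthogonal_complement_eform_invariant:
  assumes \<Phi>h: "hermitian_conjugate A E h \<Phi> \<Phi>h" and \<Phi>: "\<Phi> \<in> A1_End A E"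
    and inv: "eform_invariant A E \<Phi>h F"
  shows "eform_invariant A E \<Phi> (orthogonal_complement E h F)"
  unfolding eform_invariant_def
proof (intro ballI allI)
  fix c x v e
  assume c: "c \<in> A" "x \<in> fst c" and e: "e \<in> orthogonal_complement E h F \<inter> fib E x"
  have fib: "\<Psi> c x v u \<in> fib E x" if "\<Psi> \<in> A1_End A E" "u \<in> fib E x" for \<Psi> u
  proof -
    have "\<forall>c\<in>A. \<forall>x\<in>fst c. \<forall>e\<in>fib E x.
        (\<forall>v. \<Psi> c x v e \<in> fib E x) \<and>
        (\<forall>v. \<forall>f\<in>fib E x. \<Psi> c x v (badd E e f) = badd E (\<Psi> c x v e) (\<Psi> c x v f)) \<and>
        (\<forall>v a. \<Psi> c x v (bscale E a e) = bscale E a (\<Psi> c x v e)) \<and>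
        (\<forall>v w. \<Psi> c x (v + w) e = badd E (\<Psi> c x v e) (\<Psi> c x w e)) \<and>
        (\<forall>a v. \<Psi> c x (a *\<^sub>R v) e = bscale E (complex_of_real a) (\<Psi> c x v e))"
      using that(1) unfolding A1_End_def mem_Collect_eq by (elim conjE)
    from bspec[OF bspec[OF bspec[OF this c(1)] c(2)] that(2)] show ?thesis
      by (elim conjE) (rule spec)
  qed
  have \<Phi>e: "\<Phi> c x v e \<in> fib E x"
    using fib[OF \<Phi>] e by blast
  show "\<Phi> c x v e \<in> orthogonal_complement E h F"
    unfolding orthogonal_complement_fib[OF \<Phi>e]
  proof
    fix f
    assume f: "f \<in> F \<inter> fib E x"
    have "\<Phi>h \<in> A1_End A E"
      using \<Phi>h by (simp add: hermitian_conjugate_def A01_End_def)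
    then have \<Phi>f: "\<Phi>h c x v f \<in> fib E x"
      using fib f by blast
    have "\<Phi>h c x v f \<in> F"
      using inv c f unfolding eform_invariant_def by blast
    then have "h e (\<Phi>h c x v f) = 0"
      using e \<Phi>f orthogonal_complement_fib by blast
    then have "h (\<Phi>h c x v f) e = 0"
      using h_sym[OF _ \<Phi>f, of e] e by simp
    moreover have "h (\<Phi>h c x v f) e = h f (\<Phi> c x v e)"
      using \<Phi>h c e f unfolding hermitian_conjugate_def by blast
    ultimately show "h (\<Phi> c x v e) f = 0"
      using h_sym[OF _ \<Phi>e, of f] f by simp
  qed
qed

end


section \<open>Orthogonal decompositions of hermitian Higgs bundles\<close>

theorem proposition7:
  fixes A :: "('m::{t2_space,second_countable_topology}, 'n::finite) chart set"
    and g :: "('m, 'n) metric_field"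
    and E :: "('e, 'm, 'r::finite) vbundle"
    and \<Phi> \<Phi>h :: "('e, 'm, 'n) eform"
    and h :: "'e \<Rightarrow> 'e \<Rightarrow> complex"
    and D :: "('e, 'm, 'n) conn"
    and E' E'' :: "'e set"
  assumes "compact_kaehler_manifold A g"
    and "hermitian_higgs_bundle A E \<Phi> h"
    and "chern_connection A E h D"
    and "hermitian_conjugate A E h \<Phi> \<Phi>h"
    and "smooth_subbundle A E E'"
    and "connection_invariant A E D E'"
    and "E'' = orthogonal_complement E h E'"
    and "eform_invariant A E \<Phi> E'"
    and "eform_invariant A E \<Phi>h E'"
  shows "higgs_subbundle A E \<Phi> E' \<and> connection_invariant A E D E' \<and>
         higgs_subbundle A E \<Phi> E'' \<and> connection_invariant A E D E'' \<and>
         higgs_orthogonal_decomposition A E \<Phi> h E' E''"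
proof -
  have higgs: "higgs_bundle A E \<Phi>" and metric: "hermitian_metric A E h"
    using assms(2) by (simp_all add: hermitian_higgs_bundle_def)
  have mfd: "complex_manifold A"
    using assms(1) unfolding compact_kaehler_manifold_def by (elim conjE)
  have vb: "holomorphic_vbundle A E"
    using higgs unfolding higgs_bundle_def by (elim conjE)
  have \<Phi>: "\<Phi> \<in> holomorphic_A10_End A E"
    using higgs unfolding higgs_bundle_def by (elim conjE)
  interpret chern_bundle A E h D
    by unfold_locales (rule mfd vb metric assms(3))+
  obtain k where nf': "normal_frames A E E' k"
    by (rule smooth_subbundle_normal_frames[OF assms(5)])
  note nf'' = orthogonal_complement_normal_frames[OF nf', folded assms(7)]
  have inv'': "connection_invariant A E D E''"
    unfolding assms(7) by (rule orthogonal_complement_invariant[OF nf' assms(6)])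
  have hol: "holomorphic_subbundle A E E'" "holomorphic_subbundle A E E''"
    by (rule invariant_subbundle_holomorphic[OF nf' assms(6)],
        rule invariant_subbundle_holomorphic[OF nf'' inv''])
  have "\<Phi> \<in> A1_End A E"
    using \<Phi> unfolding holomorphic_A10_End_def A10_End_def by blast
  then have "eform_invariant A E \<Phi> E''"
    unfolding assms(7) by (rule orthogonal_complement_eform_invariant[OF assms(4) _ assms(9)])
  then have higgs': "higgs_subbundle A E \<Phi> E'" "higgs_subbundle A E \<Phi> E''"
    using hol assms(8) by (simp_all add: higgs_subbundle_def)
  have "holomorphic_direct_sum A E E' E''"
    unfolding holomorphic_direct_sum_def
    using hol orthogonal_decomposition[OF nf'] by (simp add: assms(7))
  moreover have "h f e = 0" if "f \<in> E' \<inter> fib E x" "e \<in> E'' \<inter> fib E x" for x f e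
  proof -
    have "h e f = 0"
      using that orthogonal_complement_fib unfolding assms(7) by blast
    then show ?thesis
      using h_sym[of e x f] that by simp
  qed
  ultimately have "higgs_orthogonal_decomposition A E \<Phi> h E' E''"
    unfolding higgs_orthogonal_decomposition_def using higgs' by blast
  then show ?thesis
    using higgs' assms(6) inv'' by simp
qed

end
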